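(* Let $L\ge2$ be an integer. Consider any memoryless channel $W_{\mathbf{y}|\mathbf{x}}$ over the reals (input and output alphabets $\mathbb{R}$) with input constraints $$\mathcal{P}_f=\left\{P_{\mathbf{x}}\in\Delta(\mathbb{R}):\int_{\mathbb{R}}P_{\mathbf{x}}(x)f(x)\,dx\le0\right\}$$ for some cost function $f:\mathbb{R}\to\mathbb{R}$. For $P_{\mathbf{x}}\in\mathcal{P}_f$ and $\delta>0$ let $$Z=\int_{\mathbb{R}^n}\left(\prod_{i=1}^nP_{\mathbf{x}}(x(i))\right)\mathbf{1}\left\{\sum_{i=1}^nf(x(i))\in[-\delta,0]\right\}dx.$$ Then there exists a code $\mathcal{C}\subset\mathbb{R}^n$ of rate $R$, satisfying the input constraints $\mathcal{P}_f$ and $$P_{\mathrm{e},\mathrm{avg},L-1}(\mathcal{C})\le\min_{P_{\mathbf{x}}\in\mathcal{P}_f}\ \inf_{\delta>0}\ \min_{s\ge0,\,0\le\rho\le1}e^{nR(L-1)\rho}\left(\frac{e^{s\delta}}{Z}\right)^{1+(L-1)\rho}\left[\int_{\mathbb{R}}\left(\int_{\mathbb{R}}P_{\mathbf{x}}(x)e^{sf(x)}W_{\mathbf{y}|\mathbf{x}}(y|x)^{\frac1{1+(L-1)\rho}}\,dx\right)^{1+(L-1)\rho}dy\right]^n.$$ For the same channel, there also exists a code $\mathcal{C}\subset\mathbb{R}^n$ of rate $R$, satisfying the input constraints $\mathcal{P}_f$ and $$P_{\mathrm{e},\mathrm{avg},L-1}(\mathcal{C})\le\min_{P_{\mathbf{x}}\in\mathcal{P}_f}\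 \inf_{\delta>0}\ \min_{s\ge0,\,\rho\ge1}2^{L\rho}e^{nR(L-1)\rho}\left(\frac{e^{s\delta}}{Z}\right)^{L\rho}\left[\int_{\mathbb{R}^L}\left(e^{s\sum_{k=0}^{L-1}f(x_k)}\prod_{k=0}^{L-1}P_{\mathbf{x}}(x_k)\right)\left(\int_{\mathbb{R}}\prod_{i=0}^{L-1}W_{\mathbf{y}|\mathbf{x}}(y|x_i)^{1/L}\,dy\right)^{1/\rho}d(x_0,\dots,x_{L-1})\right]^{\rho n}.$$
   Context: $\Delta(\mathbb{R})$ is the set of probability densities on $\mathbb{R}$. The channel is given by conditional densities $W_{\mathbf{y}|\mathbf{x}}(y|x)$; input $x\in\mathbb{R}^n$ produces output with density $\prod_jW_{\mathbf{y}|\mathbf{x}}(y(j)|x(j))$. A code satisfies the input constraints $\mathcal{P}_f$ if every codeword $x$ satisfies $\sum_{i=1}^nf(x(i))\le0$. A code of blocklength $n$ is a codebook $\mathcal{C}=\{x_i\}_{i=1}^M$ of $M$ indexed codewords in $\mathbb{R}^n$, of rate $R=\frac1n\ln M$, equipped with an $(L-1)$-list-decoder assigning to each $y\in\mathbb{R}^n$ a set of $L-1$ indices in $\{1,\dots,M\}$. $P_{\mathrm{e},L-1}(i,\mathcal{C})$ is the probability that, when $x_i$ is sent, the decoder's output list does not contain $i$, and $P_{\mathrm{e},\mathrm{avg},L-1}(\mathcal{C})=\frac1M\sum_iP_{\mathrm{e},L-1}(i,\mathcal{C})$. The bounds are read as $+\infty$ when $Z=0$.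
   Formalization: The minima are read as infima; when such an infimum is 0 (never attained, and the literal claim can fail, e.g. Gaussian noise with f=0), codes with error probability at most ε for every ε>0 replace a code with error at most 0. P_f nonempty and M ≥ L−1 are assumed. *)

theory Defs
  imports "HOL-Analysis.Analysis"
begin

text \<open>
  \<^term>\<open>W y x\<close> stands for the conditional density $W(y \mid x)$.  Vectors in $\mathbb{R}^n$ are
  extensional functions on \<^term>\<open>{1..n}\<close>.  All bounds live in \<^typ>\<open>ennreal\<close>, since the
  integrals occurring in them may be infinite.
\<close>

definition prob_density :: "(real \<Rightarrow> real) \<Rightarrow> bool" where
  "prob_density p \<longleftrightarrow>
     p \<in> borel_measurable borel \<and> (\<forall>x. 0 \<le> p x) \<and> (\<integral>\<^sup>+ x. ennreal (p x) \<partial>lborel) = 1"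

definition channel :: "(real \<Rightarrow> real \<Rightarrow> real) \<Rightarrow> bool" where
  "channel W \<longleftrightarrow>
     (\<lambda>(y, x). W y x) \<in> borel_measurable (borel \<Otimes>\<^sub>M borel) \<and>
     (\<forall>x. prob_density (\<lambda>y. W y x))"

text \<open>
  Integrability has to be required explicitly, because the Bochner integral of a non-integrable
  function is 0.
\<close>

definition constraint_set :: "(real \<Rightarrow> real) \<Rightarrow> (real \<Rightarrow> real) set" where
  "constraint_set f =
     {P. prob_density P \<and> integrable lborel (\<lambda>x. P x * f x) \<and>
         (LINT x|lborel. P x * f x) \<le> 0}"

definition lborel_on :: "nat set \<Rightarrow> (nat \<Rightarrow> real) measure" where
  "lborel_on I = (\<Pi>\<^sub>M i\<in>I. lborel)"

definition output_dist :: "nat \<Rightarrow> (real \<Rightarrow> real \<Rightarrow> real) \<Rightarrow> (nat \<Rightarrow> real) \<Rightarrow> (nat \<Rightarrow> real) measure" where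
  "output_dist n W x =
     density (lborel_on {1..n}) (\<lambda>y. ennreal (\<Prod>j\<in>{1..n}. W (y j) (x j)))"

text \<open>
  A code with codewords \<^term>\<open>c i\<close> for \<^term>\<open>i \<in> {1..M}\<close> and list decoder \<^term>\<open>D\<close> with
  lists of size \<^term>\<open>l\<close>.  Measurability of the decoding regions makes the error
  probabilities meaningful.
\<close>

definition list_code ::
    "nat \<Rightarrow> nat \<Rightarrow> nat \<Rightarrow> (nat \<Rightarrow> nat \<Rightarrow> real) \<Rightarrow> ((nat \<Rightarrow> real) \<Rightarrow> nat set) \<Rightarrow> bool" where
  "list_code n M l c D \<longleftrightarrow>
     (\<forall>i\<in>{1..M}. c i \<in> space (lborel_on {1..n})) \<and>
     (\<forall>y\<in>space (lborel_on {1..n}). D y \<subseteq> {1..M} \<and> card (D y) = l) \<and>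
     (\<forall>i\<in>{1..M}. {y \<in> space (lborel_on {1..n}). i \<in> D y} \<in> sets (lborel_on {1..n}))"

definition code_rate :: "nat \<Rightarrow> nat \<Rightarrow> real" where
  "code_rate n M = ln (real M) / real n"

definition satisfies_constraints ::
    "nat \<Rightarrow> nat \<Rightarrow> (real \<Rightarrow> real) \<Rightarrow> (nat \<Rightarrow> nat \<Rightarrow> real) \<Rightarrow> bool" where
  "satisfies_constraints n M f c \<longleftrightarrow> (\<forall>i\<in>{1..M}. (\<Sum>j\<in>{1..n}. f (c i j)) \<le> 0)"

definition P_err ::
    "nat \<Rightarrow> (real \<Rightarrow> real \<Rightarrow> real) \<Rightarrow> (nat \<Rightarrow> nat \<Rightarrow> real) \<Rightarrow> ((nat \<Rightarrow> real) \<Rightarrow> nat set) \<Rightarrow> nat \<Rightarrow> real" where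
  "P_err n W c D i =
     measure (output_dist n W (c i)) {y \<in> space (lborel_on {1..n}). i \<notin> D y}"

definition P_err_avg ::
    "nat \<Rightarrow> nat \<Rightarrow> (real \<Rightarrow> real \<Rightarrow> real) \<Rightarrow> (nat \<Rightarrow> nat \<Rightarrow> real) \<Rightarrow> ((nat \<Rightarrow> real) \<Rightarrow> nat set) \<Rightarrow> real" where
  "P_err_avg n M W c D = (\<Sum>i\<in>{1..M}. P_err n W c D i) / real M"

text \<open>Real powers on \<^typ>\<open>ennreal\<close>; only used with exponents \<open>a > 0\<close>.\<close>

definition epowr :: "ennreal \<Rightarrow> real \<Rightarrow> ennreal" where
  "epowr u a = (if u = \<infinity> then \<infinity> else ennreal (enn2real u powr a))"

definition shell_mass :: "nat \<Rightarrow> (real \<Rightarrow> real) \<Rightarrow> (real \<Rightarrow> real) \<Rightarrow> real \<Rightarrow> ennreal" where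
  "shell_mass n f P \<delta> =
     (\<integral>\<^sup>+ x. ennreal (\<Prod>i\<in>{1..n}. P (x i)) * indicator {x. (\<Sum>i\<in>{1..n}. f (x i)) \<in> {-\<delta>..0}} x
       \<partial>lborel_on {1..n})"

text \<open>
  The terms below are positive, and their infima \<open>random_coding_bound\<close> and
  \<open>expurgated_bound\<close> need not be minima.  An infimum equal to 0 is therefore never attained, and
  codes with exactly zero error need not exist in that case.  For example, on an additive Gaussian
  noise channel with \<open>f = 0\<close>, wider and wider uniform input densities make the bounds tend to 0,
  although every code with at least \<open>L\<close> codewords has positive error probability.
\<close>

definition rc_term ::
    "nat \<Rightarrow> nat \<Rightarrow> real \<Rightarrow> (real \<Rightarrow> real \<Rightarrow> real) \<Rightarrow> (real \<Rightarrow> real) \<Rightarrow>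
     (real \<Rightarrow> real) \<Rightarrow> real \<Rightarrow> real \<Rightarrow> real \<Rightarrow> ennreal" where
  "rc_term n L R W f P \<delta> s \<rho> =
     (let a = 1 + (real L - 1) * \<rho>; Z = shell_mass n f P \<delta> in
      if Z = 0 then \<infinity>
      else ennreal (exp (real n * R * (real L - 1) * \<rho>)) *
           epowr (ennreal (exp (s * \<delta>)) / Z) a *
           (\<integral>\<^sup>+ y. epowr (\<integral>\<^sup>+ x. ennreal (P x * exp (s * f x) * W y x powr (1 / a)) \<partial>lborel) a
             \<partial>lborel) ^ n)"

definition ex_term ::
    "nat \<Rightarrow> nat \<Rightarrow> real \<Rightarrow> (real \<Rightarrow> real \<Rightarrow> real) \<Rightarrow> (real \<Rightarrow> real) \<Rightarrow>
     (real \<Rightarrow> real) \<Rightarrow> real \<Rightarrow> real \<Rightarrow> real \<Rightarrow> ennreal" where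
  "ex_term n L R W f P \<delta> s \<rho> =
     (let Z = shell_mass n f P \<delta> in
      if Z = 0 then \<infinity>
      else ennreal (2 powr (real L * \<rho>) * exp (real n * R * (real L - 1) * \<rho>)) *
           epowr (ennreal (exp (s * \<delta>)) / Z) (real L * \<rho>) *
           epowr
             (\<integral>\<^sup>+ x. ennreal (exp (s * (\<Sum>k\<in>{0..<L}. f (x k))) * (\<Prod>k\<in>{0..<L}. P (x k))) *
                epowr (\<integral>\<^sup>+ y. ennreal (\<Prod>i\<in>{0..<L}. W y (x i) powr (1 / real L)) \<partial>lborel) (1 / \<rho>)
               \<partial>lborel_on {0..<L})
             (\<rho> * real n))"

definition random_coding_bound ::
    "nat \<Rightarrow> nat \<Rightarrow> real \<Rightarrow> (real \<Rightarrow> real \<Rightarrow> real) \<Rightarrow> (real \<Rightarrow> real) \<Rightarrow> ennreal" where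
  "random_coding_bound n L R W f =
     (INF P\<in>constraint_set f. INF \<delta>\<in>{0<..}. INF s\<in>{0..}. INF \<rho>\<in>{0..1}. rc_term n L R W f P \<delta> s \<rho>)"

definition expurgated_bound ::
    "nat \<Rightarrow> nat \<Rightarrow> real \<Rightarrow> (real \<Rightarrow> real \<Rightarrow> real) \<Rightarrow> (real \<Rightarrow> real) \<Rightarrow> ennreal" where
  "expurgated_bound n L R W f =
     (INF P\<in>constraint_set f. INF \<delta>\<in>{0<..}. INF s\<in>{0..}. INF \<rho>\<in>{1..}. ex_term n L R W f P \<delta> s \<rho>)"

end

theory Submission
  imports Defs "HOL-Probability.Infinite_Product_Measure"
begin

text \<open>
  Fix an input density \<open>P\<close> and parameters \<open>\<delta>\<close>, \<open>s\<close>, \<open>\<rho>\<close>, put \<open>m = L - 1\<close>, and draw the codewords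
  independently from the \<open>n\<close>-fold product of \<open>P\<close>, conditioned on the total cost lying in \<open>{-\<delta>..0}\<close>.
  Almost surely all codewords then satisfy the cost constraint, and the conditioned density is at most \<open>e^(s \<delta>) / Z\<close> times the product
  of the tilted densities \<open>P x * e^(s f x)\<close>.  Averages over such codewords are therefore bounded by
  products of single-letter integrals, and decoding to the \<open>m\<close> most likely codewords gives both
  bounds.

  For the random coding bound put \<open>a = 1 + m \<rho>\<close> and \<open>v i = W(y | c i)^(1/a)\<close>.  If \<open>c i\<close> is not among
  the \<open>m\<close> most likely codewords, then the product of \<open>v j\<close> over the list is at least \<open>v i ^ m\<close>, so
  the error probability at \<open>y\<close> is controlled by \<open>v i\<close> times the \<open>\<rho>\<close>-th power of an elementary
  symmetric sum of the other \<open>v j\<close>.  Concavity of the \<open>\<rho>\<close>-th power allows the codewords other than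
  \<open>c i\<close> to be averaged inside it.

  For the expurgated bound \<open>2 M\<close> codewords are drawn.  The error probability of \<open>c i\<close> is at most the
  sum, over all \<open>m\<close>-sets \<open>J\<close> of competitors, of the \<open>L\<close>-fold Bhattacharyya affinity of \<open>c i\<close> and the
  codewords in \<open>J\<close>.  Since \<open>\<rho> \<ge> 1\<close>, the \<open>1/\<rho>\<close>-th power of this sum is at most the sum of the \<open>1/\<rho>\<close>-th
  powers of the affinities, whose mean factors over the coordinates.  By Markov's inequality the value
  for at least half of the codewords is at most twice a bound for this mean, and these are kept.

  The infimum in the bounds need not be attained, so a code meeting each single term is not enough:
  the codes found for terms close to a positive infimum might all stay slightly above it.  What closes
  this gap is a gain by the factor \<open>1 - 1 / (2 M) < 1\<close>, the same for all parameters, in every term.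
  In the expurgated bound it comes from replacing \<open>(2 M)^m\<close> by a binomial coefficient of \<open>2 M - 1\<close>.
  In the random coding bound this kind of gain would disappear as \<open>\<rho>\<close> tends to 0.  There it comes from
  the pointwise inequality \<open>list_error_pointwise\<close>, which also counts what the codewords inside the
  list contribute to the sum.  The tangent-line argument is in \<open>rc_integrand_mean_le\<close>, the selection
  of good codewords in \<open>exists_expurgated_code\<close>, and the passage to the infimum in
  \<open>infimum_achieved_with_slack\<close>.
\<close>

section \<open>Inequalities for powers and extended powers\<close>

lemma choose_le_power: "n choose m \<le> n ^ m"
  by (cases "m \<le> n") (simp_all add: binomial_le_pow binomial_eq_0)

text \<open>
  Jensen's inequality for the concave function \<open>u powr r\<close>, in the form of its tangent line at \<open>\<mu>\<close>.
  The right-hand side is affine in \<open>u\<close>, so that means can be taken term by term.  With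
  \<open>0 powr 0 = 0\<close> it also covers \<open>r = 0\<close>.
\<close>

lemma powr_le_tangent:
  fixes u \<mu> r :: real
  assumes "0 \<le> u" "0 < \<mu>" "0 \<le> r" "r \<le> 1"
  shows "u powr r \<le> (1 - r) * \<mu> powr r + r * \<mu> powr (r - 1) * u"
proof (cases "u = 0")
  case True
  then show ?thesis using assms by simp
next
  case False
  define t where "t = u / \<mu>"
  have t: "t > 0" "u = t * \<mu>" using False assms by (auto simp: t_def)
  have "t powr r = exp ((1 - r) * 0 + r * ln t)" using t by (simp add: powr_def)
  also have "\<dots> \<le> (1 - r) * exp 0 + r * exp (ln t)"
    using convex_onD[OF exp_convex, of r 0 "ln t"] assms by simp
  finally have "t powr r \<le> (1 - r) + r * t" using t by simp
  then have "t powr r * \<mu> powr r \<le> ((1 - r) + r * t) * \<mu> powr r"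
    by (intro mult_right_mono) auto
  also have "\<mu> powr r = \<mu> powr (r - 1) * \<mu>" using assms by (simp add: powr_diff)
  finally show ?thesis using t assms by (simp add: powr_mult powr_diff field_simps)
qed

text \<open>
  Both summands are fractions of their sum, and raising a fraction to a power \<open>r \<le> 1\<close> does not
  decrease it.
\<close>

lemma powr_add_le_add_powr:
  fixes x y r :: real
  assumes "0 \<le> x" "0 \<le> y" "0 < r" "r \<le> 1"
  shows "(x + y) powr r \<le> x powr r + y powr r"
proof (cases "x + y = 0")
  case True
  then show ?thesis by simp
next
  case False
  define s where "s = x + y"
  have s: "s > 0" using False assms by (simp add: s_def)
  have le: "z / s * s powr r \<le> z powr r" if "0 \<le> z" "z \<le> s" for z
  proof -
    have "(z / s) powr 1 \<le> (z / s) powr r"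
      using that s assms by (intro powr_mono') auto
    then have "z / s * s powr r \<le> (z / s) powr r * s powr r"
      using that s by (intro mult_right_mono) auto
    also have "\<dots> = z powr r" using that s by (simp add: powr_divide)
    finally show ?thesis .
  qed
  have "s powr r = x / s * s powr r + y / s * s powr r"
    using s by (simp add: s_def flip: add_divide_distrib distrib_right)
  also have "\<dots> \<le> x powr r + y powr r"
    using assms by (intro add_mono le) (auto simp: s_def)
  finally show ?thesis by (simp add: s_def)
qed

lemma epowr_ennreal: "0 \<le> x \<Longrightarrow> epowr (ennreal x) a = ennreal (x powr a)"
  by (simp add: epowr_def)

lemma epowr_infinity [simp]: "epowr \<infinity> a = \<infinity>" "epowr top a = top"
  by (auto simp: epowr_def)

lemma epowr_0 [simp]: "epowr 0 a = 0"
  by (simp add: epowr_def)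

lemma epowr_1 [simp]: "epowr x 1 = x"
  by (cases x) (auto simp: epowr_def)

lemma epowr_one [simp]: "epowr 1 a = 1"
  using epowr_ennreal[of 1 a] by simp

lemma epowr_mono:
  assumes "x \<le> y" "0 \<le> a" shows "epowr x a \<le> epowr y a"
  using assms by (cases x; cases y) (auto simp: epowr_ennreal top_unique intro!: ennreal_leI powr_mono2)

lemma epowr_mult: "epowr (x * y) a = epowr x a * epowr y a"
proof (cases x; cases y)
  fix r s assume "0 \<le> r" "x = ennreal r" "0 \<le> s" "y = ennreal s"
  then show ?thesis by (simp add: epowr_ennreal powr_mult flip: ennreal_mult)
qed (auto simp: epowr_ennreal ennreal_mult_top ennreal_top_mult powr_eq_0_iff)

lemma epowr_prod: "finite I \<Longrightarrow> epowr (\<Prod>i\<in>I. x i) a = (\<Prod>i\<in>I. epowr (x i) a)"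
  by (induction I rule: finite_induct) (auto simp: epowr_mult)

lemma epowr_epowr: "epowr (epowr x a) b = epowr x (a * b)"
  by (cases x) (auto simp: epowr_ennreal powr_powr)

lemma epowr_of_nat: "0 < n \<Longrightarrow> epowr x (real n) = x ^ n"
proof (cases x)
  case (real r)
  assume n: "0 < n"
  show ?thesis
  proof (cases "r = 0")
    case True then show ?thesis using real n by simp
  next
    case False then show ?thesis using real n by (simp add: epowr_ennreal powr_realpow ennreal_power)
  qed
qed (simp add: power_eq_top_ennreal top_power_ennreal)

lemma epowr_sum_le:
  assumes "finite I" "0 < r" "r \<le> 1"
  shows "epowr (\<Sum>i\<in>I. x i) r \<le> (\<Sum>i\<in>I. epowr (x i) r)"
  using assms(1)
proof (induction I rule: finite_induct)
  case (insert i I)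
  have "epowr (u + v) r \<le> epowr u r + epowr v r" for u v
    using assms powr_add_le_add_powr[of "enn2real u" "enn2real v" r]
    by (cases u; cases v) (auto simp: epowr_ennreal simp flip: ennreal_plus intro: ennreal_leI)
  from this[of "x i" "sum x I"] show ?case using insert
    by (auto intro: order_trans add_left_mono)
qed simp

lemma measurable_epowr [measurable]:
  assumes [measurable]: "g \<in> borel_measurable N"
  shows "(\<lambda>x. epowr (g x) a) \<in> borel_measurable N"
  unfolding epowr_def by measurable

section \<open>Integrals over products of measures\<close>

text \<open>
  Tonelli's theorem for an array with rows in \<open>K\<close> and columns in \<open>J\<close>.  The sets on which the two
  iterated product measures would have to be compared are not rectangles in the single coordinates;
  integrating out one row at a time avoids the comparison.
\<close>

lemma nn_integral_PiM_transpose: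
  fixes H :: "'j \<Rightarrow> ('k \<Rightarrow> 'a) \<Rightarrow> ennreal"
  assumes N: "sigma_finite_measure N" and J: "finite J" and K: "finite K"
    and H: "\<And>j. j \<in> J \<Longrightarrow> H j \<in> borel_measurable (\<Pi>\<^sub>M k\<in>K. N)"
  shows "(\<integral>\<^sup>+ x. (\<Prod>j\<in>J. H j (\<lambda>k\<in>K. x k j)) \<partial>(\<Pi>\<^sub>M k\<in>K. \<Pi>\<^sub>M j\<in>J. N)) =
    (\<Prod>j\<in>J. \<integral>\<^sup>+ u. H j u \<partial>(\<Pi>\<^sub>M k\<in>K. N))"
  using K H
proof (induction K arbitrary: H rule: finite_induct)
  case empty
  interpret A: product_sigma_finite "\<lambda>_::'k. N" using N by (rule product_sigma_finite.intro)
  interpret NJ: finite_product_sigma_finite "\<lambda>_::'j. N" J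
    using N J by (auto intro!: finite_product_sigma_finite.intro product_sigma_finite.intro finite_product_sigma_finite_axioms.intro)
  interpret B: product_sigma_finite "\<lambda>_::'k. \<Pi>\<^sub>M j\<in>J. N"
    by (intro product_sigma_finite.intro) (rule NJ.sigma_finite_measure_axioms)
  show ?case by (simp add: A.nn_integral_empty B.nn_integral_empty restrict_def space_PiM_empty emeasure_PiM_empty)
next
  case (insert k K)
  interpret A: product_sigma_finite "\<lambda>_::'k. N" using N by (rule product_sigma_finite.intro)
  interpret C: product_sigma_finite "\<lambda>_::'j. N" using N by (rule product_sigma_finite.intro)
  interpret NJ: finite_product_sigma_finite "\<lambda>_::'j. N" J
    using N J by (auto intro!: finite_product_sigma_finite.intro product_sigma_finite.intro finite_product_sigma_finite_axioms.intro)
  interpret B: product_sigma_finite "\<lambda>_::'k. \<Pi>\<^sub>M j\<in>J. N"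
    by (intro product_sigma_finite.intro) (rule NJ.sigma_finite_measure_axioms)
  note [measurable] = insert.prems
  have upd [measurable]: "(\<lambda>(u, z). H j (u(k := z))) \<in> borel_measurable ((\<Pi>\<^sub>M k\<in>K. N) \<Otimes>\<^sub>M N)"
    if "j \<in> J" for j
  proof -
    have "(\<lambda>p. (fst p)(k := snd p)) \<in> (\<Pi>\<^sub>M k\<in>K. N) \<Otimes>\<^sub>M N \<rightarrow>\<^sub>M (\<Pi>\<^sub>M k\<in>insert k K. N)"
      by (rule measurable_fun_upd[where J=K]) auto
    from measurable_compose[OF this insert.prems[OF that]]
    show ?thesis by (simp add: case_prod_beta' fun_upd_def)
  qed
  have sl [measurable]: "(\<lambda>x. \<lambda>k\<in>K'. x k j) \<in> (\<Pi>\<^sub>M k\<in>K'. \<Pi>\<^sub>M j\<in>J. N) \<rightarrow>\<^sub>M (\<Pi>\<^sub>M k\<in>K'. N)"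
    if "j \<in> J" for j and K' :: "'k set"
  proof (rule measurable_restrict)
    fix k assume "k \<in> K'"
    have "(\<lambda>x. x k) \<in> (\<Pi>\<^sub>M k\<in>K'. \<Pi>\<^sub>M j\<in>J. N) \<rightarrow>\<^sub>M (\<Pi>\<^sub>M j\<in>J. N)"
      using \<open>k \<in> K'\<close> by (rule measurable_component_singleton)
    from measurable_compose[OF this measurable_component_singleton[OF that]]
    show "(\<lambda>x. x k j) \<in> (\<Pi>\<^sub>M k\<in>K'. \<Pi>\<^sub>M j\<in>J. N) \<rightarrow>\<^sub>M N" .
  qed
  have eq: "(\<lambda>k'\<in>insert k K. (x(k := z)) k' j) = (\<lambda>k'\<in>K. x k' j)(k := z j)" for x :: "'k \<Rightarrow> 'j \<Rightarrow> 'a" and z j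
    using insert.hyps by (auto simp: fun_eq_iff restrict_def)
  have comp: "(\<lambda>y. H j ((\<lambda>k'\<in>K. x k' j)(k := y))) \<in> borel_measurable N"
    if "j \<in> J" "x \<in> space (\<Pi>\<^sub>M k\<in>K. \<Pi>\<^sub>M j\<in>J. N)" for x j
  proof -
    have "(\<lambda>k'\<in>K. x k' j) \<in> space (\<Pi>\<^sub>M k\<in>K. N)"
      using measurable_space[OF sl[OF that(1)] that(2)] .
    from measurable_Pair2[OF upd[OF that(1)] this] show ?thesis by simp
  qed
  have "(\<integral>\<^sup>+ x. (\<Prod>j\<in>J. H j (\<lambda>k\<in>insert k K. x k j)) \<partial>(\<Pi>\<^sub>M k\<in>insert k K. \<Pi>\<^sub>M j\<in>J. N)) =
    (\<integral>\<^sup>+ x. (\<integral>\<^sup>+ z. (\<Prod>j\<in>J. H j (\<lambda>k'\<in>insert k K. (x(k := z)) k' j)) \<partial>(\<Pi>\<^sub>M j\<in>J. N)) \<partial>(\<Pi>\<^sub>M k\<in>K. \<Pi>\<^sub>M j\<in>J. N))"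
    using insert.hyps
    by (intro B.product_nn_integral_insert borel_measurable_prod_ennreal measurable_compose[OF sl] insert.prems)
  also have "\<dots> = (\<integral>\<^sup>+ x. (\<integral>\<^sup>+ z. (\<Prod>j\<in>J. H j ((\<lambda>k'\<in>K. x k' j)(k := z j))) \<partial>(\<Pi>\<^sub>M j\<in>J. N)) \<partial>(\<Pi>\<^sub>M k\<in>K. \<Pi>\<^sub>M j\<in>J. N))"
    by (simp only: eq)
  also have "\<dots> = (\<integral>\<^sup>+ x. (\<Prod>j\<in>J. (\<integral>\<^sup>+ z. H j ((\<lambda>k'\<in>K. x k' j)(k := z)) \<partial>N)) \<partial>(\<Pi>\<^sub>M k\<in>K. \<Pi>\<^sub>M j\<in>J. N))"
    using J comp by (intro nn_integral_cong C.product_nn_integral_prod) auto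
  also have "\<dots> = (\<Prod>j\<in>J. \<integral>\<^sup>+ u. (\<integral>\<^sup>+ z. H j (u(k := z)) \<partial>N) \<partial>(\<Pi>\<^sub>M k\<in>K. N))"
  proof (rule insert.IH)
    show "(\<lambda>u. \<integral>\<^sup>+ z. H j (u(k := z)) \<partial>N) \<in> borel_measurable (\<Pi>\<^sub>M k\<in>K. N)" if "j \<in> J" for j
      using sigma_finite_measure.borel_measurable_nn_integral[OF N upd[OF that]] by simp
  qed
  also have "\<dots> = (\<Prod>j\<in>J. \<integral>\<^sup>+ u. H j u \<partial>(\<Pi>\<^sub>M k\<in>insert k K. N))"
    using insert.hyps insert.prems by (intro prod.cong refl A.product_nn_integral_insert[symmetric]) auto
  finally show ?case .
qed

text \<open>
  The hypothesis says that \<open>Q\<close> has at most the density \<open>C * q\<close> with respect to \<open>N\<close>, stated for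
  integrals because that is how it is used in each step of the induction.
\<close>

lemma nn_integral_PiM_mono_density:
  fixes q :: "'a \<Rightarrow> ennreal"
  assumes Q: "sigma_finite_measure Q" and N: "sigma_finite_measure N" and sets: "sets Q = sets N"
    and q [measurable]: "q \<in> borel_measurable N"
    and dom: "\<And>\<psi>. \<psi> \<in> borel_measurable N \<Longrightarrow> (\<integral>\<^sup>+ x. \<psi> x \<partial>Q) \<le> C * (\<integral>\<^sup>+ x. q x * \<psi> x \<partial>N)"
    and K: "finite K" and \<phi>: "\<phi> \<in> borel_measurable (\<Pi>\<^sub>M k\<in>K. N)"
  shows "(\<integral>\<^sup>+ x. \<phi> x \<partial>(\<Pi>\<^sub>M k\<in>K. Q)) \<le> C ^ card K * (\<integral>\<^sup>+ x. (\<Prod>k\<in>K. q (x k)) * \<phi> x \<partial>(\<Pi>\<^sub>M k\<in>K. N))"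
  using K \<phi>
proof (induction K arbitrary: \<phi> rule: finite_induct)
  case empty
  interpret A: product_sigma_finite "\<lambda>_. N" using N by (rule product_sigma_finite.intro)
  interpret B: product_sigma_finite "\<lambda>_. Q" using Q by (rule product_sigma_finite.intro)
  show ?case by (simp add: A.nn_integral_empty B.nn_integral_empty)
next
  case (insert k K)
  interpret A: product_sigma_finite "\<lambda>_. N" using N by (rule product_sigma_finite.intro)
  interpret B: product_sigma_finite "\<lambda>_. Q" using Q by (rule product_sigma_finite.intro)
  have setsP: "sets (\<Pi>\<^sub>M k\<in>I. Q) = sets (\<Pi>\<^sub>M k\<in>I. N)" for I using sets by (intro sets_PiM_cong) auto
  note [measurable] = insert.prems
  have upd [measurable]: "(\<lambda>(u, z). \<phi> (u(k := z))) \<in> borel_measurable ((\<Pi>\<^sub>M k\<in>K. N) \<Otimes>\<^sub>M N)"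
  proof -
    have "(\<lambda>p. (fst p)(k := snd p)) \<in> (\<Pi>\<^sub>M k\<in>K. N) \<Otimes>\<^sub>M N \<rightarrow>\<^sub>M (\<Pi>\<^sub>M k\<in>insert k K. N)"
      by (rule measurable_fun_upd[where J=K]) auto
    from measurable_compose[OF this insert.prems]
    show ?thesis by (simp add: case_prod_beta' fun_upd_def)
  qed
  have upd': "(\<lambda>z. \<phi> (u(k := z))) \<in> borel_measurable N" if "u \<in> space (\<Pi>\<^sub>M k\<in>K. N)" for u
    using measurable_Pair2[OF upd that] by simp
  have meas: "(\<lambda>u. \<integral>\<^sup>+ z. q z * \<phi> (u(k := z)) \<partial>N) \<in> borel_measurable (\<Pi>\<^sub>M k\<in>K. N)"
    using sigma_finite_measure.borel_measurable_nn_integral[OF N, of "\<lambda>u z. q z * \<phi> (u(k := z))"] by simp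
  have "(\<integral>\<^sup>+ x. \<phi> x \<partial>(\<Pi>\<^sub>M k\<in>insert k K. Q)) = (\<integral>\<^sup>+ x. (\<integral>\<^sup>+ z. \<phi> (x(k := z)) \<partial>Q) \<partial>(\<Pi>\<^sub>M k\<in>K. Q))"
    using insert.hyps insert.prems by (intro B.product_nn_integral_insert) (auto cong: measurable_cong_sets[OF setsP])
  also have "\<dots> \<le> (\<integral>\<^sup>+ x. C * (\<integral>\<^sup>+ z. q z * \<phi> (x(k := z)) \<partial>N) \<partial>(\<Pi>\<^sub>M k\<in>K. Q))"
    by (intro nn_integral_mono dom upd') (simp add: sets_eq_imp_space_eq[OF setsP])
  also have "\<dots> = C * (\<integral>\<^sup>+ x. (\<integral>\<^sup>+ z. q z * \<phi> (x(k := z)) \<partial>N) \<partial>(\<Pi>\<^sub>M k\<in>K. Q))"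
    using meas by (intro nn_integral_cmult) (auto cong: measurable_cong_sets[OF setsP])
  also have "\<dots> \<le> C * (C ^ card K * (\<integral>\<^sup>+ x. (\<Prod>k\<in>K. q (x k)) * (\<integral>\<^sup>+ z. q z * \<phi> (x(k := z)) \<partial>N) \<partial>(\<Pi>\<^sub>M k\<in>K. N)))"
    by (intro mult_left_mono insert.IH meas) auto
  also have "(\<integral>\<^sup>+ x. (\<Prod>k\<in>K. q (x k)) * (\<integral>\<^sup>+ z. q z * \<phi> (x(k := z)) \<partial>N) \<partial>(\<Pi>\<^sub>M k\<in>K. N))
     = (\<integral>\<^sup>+ x. (\<integral>\<^sup>+ z. (\<Prod>k\<in>K. q (x k)) * (q z * \<phi> (x(k := z))) \<partial>N) \<partial>(\<Pi>\<^sub>M k\<in>K. N))"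
    by (intro nn_integral_cong nn_integral_cmult[symmetric]) (use upd' in measurable)
  also have "\<dots> = (\<integral>\<^sup>+ x. (\<integral>\<^sup>+ z. (\<Prod>k'\<in>insert k K. q ((x(k := z)) k')) * \<phi> (x(k := z)) \<partial>N) \<partial>(\<Pi>\<^sub>M k\<in>K. N))"
  proof (intro nn_integral_cong)
    fix x z
    have "(\<Prod>k'\<in>K. q ((x(k := z)) k')) = (\<Prod>k\<in>K. q (x k))"
      using insert.hyps by (intro prod.cong) auto
    then show "(\<Prod>k\<in>K. q (x k)) * (q z * \<phi> (x(k := z))) = (\<Prod>k'\<in>insert k K. q ((x(k := z)) k')) * \<phi> (x(k := z))"
      using insert.hyps by (simp add: mult_ac)
  qed
  also have "\<dots> = (\<integral>\<^sup>+ x. (\<Prod>k\<in>insert k K. q (x k)) * \<phi> x \<partial>(\<Pi>\<^sub>M k\<in>insert k K. N))"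
    using insert.hyps insert.prems by (intro A.product_nn_integral_insert[symmetric]) auto
  finally show ?case using insert.hyps by (simp add: mult_ac)
qed

lemma nn_integral_PiM_iid_prod:
  assumes Q: "prob_space Q" and A: "finite A" "S \<subseteq> A" and \<phi>: "\<phi> \<in> borel_measurable Q"
  shows "(\<integral>\<^sup>+ c. (\<Prod>j\<in>S. \<phi> (c j)) \<partial>(\<Pi>\<^sub>M i\<in>A. Q)) = (\<integral>\<^sup>+ x. \<phi> x \<partial>Q) ^ card S"
proof -
  interpret Q: prob_space Q by fact
  interpret B: product_sigma_finite "\<lambda>_. Q"
    by (rule product_sigma_finite.intro) (rule Q.sigma_finite_measure_axioms)
  have "(\<integral>\<^sup>+ c. (\<Prod>j\<in>S. \<phi> (c j)) \<partial>(\<Pi>\<^sub>M i\<in>A. Q)) =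
     (\<integral>\<^sup>+ c. (\<Prod>j\<in>A. (if j \<in> S then \<phi> else (\<lambda>_. 1)) (c j)) \<partial>(\<Pi>\<^sub>M i\<in>A. Q))"
    using A by (intro nn_integral_cong) (auto simp: if_distribR prod.If_cases Int_absorb1)
  also have "\<dots> = (\<Prod>j\<in>A. \<integral>\<^sup>+ x. (if j \<in> S then \<phi> else (\<lambda>_. 1)) x \<partial>Q)"
    using A \<phi> by (intro B.product_nn_integral_prod) auto
  also have "\<dots> = (\<Prod>j\<in>A. if j \<in> S then \<integral>\<^sup>+ x. \<phi> x \<partial>Q else 1)"
    by (intro prod.cong) (auto simp: Q.emeasure_space_1)
  also have "\<dots> = (\<integral>\<^sup>+ x. \<phi> x \<partial>Q) ^ card S"
    using A by (simp add: prod.If_cases Int_absorb1)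
  finally show ?thesis .
qed

section \<open>Choosing the largest entries of a finite family\<close>

text \<open>
  Ties are broken by the index, which makes this a strict linear order for every \<open>w\<close>.
\<close>

definition outranks :: "(nat \<Rightarrow> real) \<Rightarrow> nat \<Rightarrow> nat \<Rightarrow> bool" where
  "outranks w j i \<longleftrightarrow> w i < w j \<or> (w i = w j \<and> j < i)"

text \<open>
  The list is described by counting rather than by sorting, so that the decoding regions are visibly
  measurable.
\<close>

definition top_list :: "nat set \<Rightarrow> nat \<Rightarrow> (nat \<Rightarrow> real) \<Rightarrow> nat set" where
  "top_list A m w = {i \<in> A. card {j \<in> A. outranks w j i} < m}"

lemma top_list_subset: "top_list A m w \<subseteq> A"
  by (auto simp: top_list_def)

lemma rank_less:
  assumes "finite A" "j \<in> A" "outranks w j i"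
  shows "card {k \<in> A. outranks w k j} < card {k \<in> A. outranks w k i}"
proof (rule psubset_card_mono)
  show "{k \<in> A. outranks w k j} \<subset> {k \<in> A. outranks w k i}"
    using assms(2,3) by (auto simp: outranks_def)
qed (use assms in auto)

text \<open>
  The number of elements outranking \<open>i\<close> is a bijection from \<open>A\<close> onto \<open>{..<card A}\<close>, because it is
  strictly monotone along a linear order.
\<close>

lemma card_top_list:
  assumes "finite A" "m \<le> card A"
  shows "card (top_list A m w) = m"
proof -
  define rank where "rank = (\<lambda>i. card {k \<in> A. outranks w k i})"
  have inj: "inj_on rank A"
  proof (rule inj_onI, rule ccontr)
    fix i j assume ij: "i \<in> A" "j \<in> A" "rank i = rank j" "i \<noteq> j"
    then have "outranks w i j \<or> outranks w j i" by (auto simp: outranks_def)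
    then show False using rank_less[OF assms(1)] ij by (force simp: rank_def)
  qed
  have "rank ` A \<subseteq> {..<card A}"
  proof
    fix r assume "r \<in> rank ` A"
    then obtain i where i: "i \<in> A" "r = rank i" by auto
    have "{k \<in> A. outranks w k i} \<subset> A" using i by (auto simp: outranks_def)
    then show "r \<in> {..<card A}" using i assms(1) by (auto simp: rank_def psubset_card_mono)
  qed
  then have im: "rank ` A = {..<card A}"
    using card_image[OF inj] by (intro card_subset_eq) auto
  have "rank ` top_list A m w = {..<m}"
  proof -
    have "rank ` top_list A m w = rank ` A \<inter> {..<m}" by (auto simp: top_list_def rank_def)
    with im assms(2) show ?thesis by auto
  qed
  moreover have "inj_on rank (top_list A m w)" using inj top_list_subset by (rule inj_on_subset)
  ultimately show ?thesis using card_image by fastforce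
qed

lemma top_list_maximal:
  assumes "finite A" "k \<in> top_list A m w" "i \<in> A - top_list A m w"
  shows "w i \<le> w k"
proof (rule ccontr)
  assume "\<not> w i \<le> w k"
  then have "outranks w i k" by (simp add: outranks_def)
  then show False using rank_less[OF assms(1), of i w k] assms(2,3) by (auto simp: top_list_def)
qed

lemma top_list_measurable:
  fixes w :: "nat \<Rightarrow> 'a \<Rightarrow> real"
  assumes [simp]: "finite A" and [measurable]: "\<And>i. i \<in> A \<Longrightarrow> w i \<in> borel_measurable N"
  shows "{y \<in> space N. i \<in> top_list A m (\<lambda>k. w k y)} \<in> sets N"
proof (cases "i \<in> A")
  case True
  note [measurable] = assms(2)[OF True]
  have "Measurable.pred N (\<lambda>y. card {j \<in> A. outranks (\<lambda>k. w k y) j i} < m)"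
  proof -
    have eq: "card {j \<in> A. outranks (\<lambda>k. w k y) j i}
       = (\<Sum>j\<in>A. if outranks (\<lambda>k. w k y) j i then 1 else 0)" for y
      by (simp add: sum.If_cases Int_def)
    show ?thesis unfolding eq outranks_def by measurable
  qed
  then show ?thesis using True by (simp add: top_list_def pred_def)
qed (auto simp: top_list_def)

text \<open>
  Here \<open>v i powr (1 + m \<rho>)\<close> is the likelihood of \<open>i\<close>, and \<open>D\<close> consists of \<open>m\<close> indices with the
  largest likelihoods.  Let \<open>u\<close> be the largest \<open>v\<close> outside \<open>D\<close>.  An index outside \<open>D\<close> contributes at
  least its own likelihood on the right, since \<open>D\<close> is one of the sets \<open>J\<close>.  An index in \<open>D\<close> contributes
  at least \<open>u powr (1 + m \<rho>)\<close>: exchange it in \<open>D\<close> for the maximiser of \<open>v\<close> outside \<open>D\<close> to get a set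
  \<open>J\<close>.  As all the likelihoods on the left are at most \<open>u powr (1 + m \<rho>)\<close>, these \<open>m\<close> further terms
  amount to at least the fraction \<open>m / (card A - m)\<close> of the left-hand sum.  This is the gain that persists at
  \<open>\<rho> = 0\<close>, where it says that a list of the \<open>m\<close> most likely codewords is right with probability at
  least \<open>m / card A\<close>.
\<close>

lemma list_error_pointwise:
  fixes v :: "nat \<Rightarrow> real"
  assumes A: "finite A" and D: "D \<subseteq> A" "card D = m" and m: "0 < m"
    and v: "\<And>i. i \<in> A \<Longrightarrow> 0 \<le> v i"
    and max: "\<And>i k. i \<in> A - D \<Longrightarrow> k \<in> D \<Longrightarrow> v i \<le> v k"
    and \<rho>: "0 \<le> \<rho>"
  shows "real (card A) * (\<Sum>i\<in>A - D. v i powr (1 + real m * \<rho>)) \<le>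
    (real (card A) - real m) *
      (\<Sum>i\<in>A. v i * (\<Sum>J | J \<subseteq> A - {i} \<and> card J = m. \<Prod>j\<in>J. v j) powr \<rho>)"
proof (cases "A - D = {}")
  case True
  then have "A = D" using D by auto
  then show ?thesis using D by simp
next
  case False
  define a where "a = 1 + real m * \<rho>"
  define e where "e = (\<lambda>i. \<Sum>J | J \<subseteq> A - {i} \<and> card J = m. \<Prod>j\<in>J. v j)"
  have finD: "finite D" using A D finite_subset by blast
  have fin: "finite {J. J \<subseteq> A - {i} \<and> card J = m}" for i
    using A by simp
  have e_ge: "z * z powr (real m * \<rho>) \<le> z * e i powr \<rho>"
    if "J \<subseteq> A - {i}" "card J = m" "0 \<le> z" "\<And>j. j \<in> J \<Longrightarrow> z \<le> v j" for i J z
  proof (cases "z = 0")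
    case False
    have "z ^ m = (\<Prod>j\<in>J. z)" using that by simp
    also have "\<dots> \<le> (\<Prod>j\<in>J. v j)" using that by (intro prod_mono) auto
    also have "\<dots> \<le> e i" unfolding e_def
      using that fin v by (intro member_le_sum) (auto intro!: prod_nonneg)
    finally have "(z ^ m) powr \<rho> \<le> e i powr \<rho>"
      using \<rho> that by (intro powr_mono2) auto
    moreover have "(z ^ m) powr \<rho> = z powr (real m * \<rho>)"
      using False that by (simp add: powr_powr flip: powr_realpow)
    ultimately show ?thesis using that by (intro mult_left_mono) auto
  qed simp
  have split: "z powr a = z * z powr (real m * \<rho>)" if "0 \<le> z" for z
    using that by (simp add: a_def powr_add)
  have low: "v i powr a \<le> v i * e i powr \<rho>" if "i \<in> A - D" for i
    unfolding split[OF v[of i, OF DiffD1[OF that]]]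
    using that D max v by (intro e_ge[of D]) auto
  have "Max (v ` (A - D)) \<in> v ` (A - D)" using A False by (intro Max_in) auto
  then obtain i0 where i0: "i0 \<in> A - D" "v i0 = Max (v ` (A - D))" by auto
  have i0_max: "v i \<le> v i0" if "i \<in> A - D" for i
    using that A i0 by simp
  define u where "u = v i0"
  have u0: "0 \<le> u" using v[of i0] i0(1) by (simp add: u_def)
  have high: "u powr a \<le> v i * e i powr \<rho>" if "i \<in> D" for i
  proof -
    have "u powr a = u * u powr (real m * \<rho>)" using split u0 .
    also have "\<dots> \<le> u * e i powr \<rho>"
      using i0(1) D finD that max m u0
      by (intro e_ge[of "insert i0 (D - {i})"]) (auto simp: u_def)
    also have "\<dots> \<le> v i * e i powr \<rho>"
      using max[OF i0(1) that] by (intro mult_right_mono) (auto simp: u_def)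
    finally show ?thesis .
  qed
  define S where "S = (\<Sum>i\<in>A - D. v i powr a)"
  have cardAD: "real (card (A - D)) = real (card A) - real m"
    using D A finD card_mono by (force simp: card_Diff_subset of_nat_diff)
  have "S \<le> (\<Sum>i\<in>A - D. u powr a)" unfolding S_def
    using i0_max v m \<rho> by (intro sum_mono powr_mono2) (auto simp: u_def a_def)
  then have S1: "S \<le> (real (card A) - real m) * u powr a" using cardAD by simp
  have "S + real m * u powr a \<le> (\<Sum>i\<in>A - D. v i * e i powr \<rho>) + (\<Sum>i\<in>D. v i * e i powr \<rho>)"
    unfolding S_def
  proof (rule add_mono)
    show "real m * u powr a \<le> (\<Sum>i\<in>D. v i * e i powr \<rho>)"
      using sum_mono[OF high, of D] D by simp
  qed (rule sum_mono[OF low])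
  also have "\<dots> = (\<Sum>i\<in>A. v i * e i powr \<rho>)"
    using A D by (simp add: sum.subset_diff)
  finally have "(real (card A) - real m) * (S + real m * u powr a)
      \<le> (real (card A) - real m) * (\<Sum>i\<in>A. v i * e i powr \<rho>)"
    using cardAD by (intro mult_left_mono) (auto simp flip: cardAD)
  moreover have "real m * S \<le> real m * ((real (card A) - real m) * u powr a)"
    using S1 by (intro mult_left_mono) auto
  ultimately show ?thesis unfolding S_def a_def e_def by (simp add: algebra_simps)
qed

section \<open>Block likelihoods and maximum-likelihood list decoding\<close>

abbreviation block_space :: "nat \<Rightarrow> (nat \<Rightarrow> real) measure" where
  "block_space n \<equiv> lborel_on {1..n}"

definition block_likelihood :: "nat \<Rightarrow> (real \<Rightarrow> real \<Rightarrow> real) \<Rightarrow> (nat \<Rightarrow> real) \<Rightarrow> (nat \<Rightarrow> real) \<Rightarrow> real" where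
  "block_likelihood n W y x = (\<Prod>j\<in>{1..n}. W (y j) (x j))"

lemma channel_nonneg: "channel W \<Longrightarrow> 0 \<le> W y x"
  by (simp add: channel_def prob_density_def)

lemma block_likelihood_nonneg: "channel W \<Longrightarrow> 0 \<le> block_likelihood n W y x"
  by (auto simp: block_likelihood_def channel_nonneg intro!: prod_nonneg)

lemma block_likelihood_powr:
  "channel W \<Longrightarrow> block_likelihood n W y x powr r = (\<Prod>j\<in>{1..n}. W (y j) (x j) powr r)"
  by (simp add: block_likelihood_def prod_powr_distrib channel_nonneg)

lemma sigma_finite_lborel_on: "finite I \<Longrightarrow> sigma_finite_measure (lborel_on I)"
  unfolding lborel_on_def
  by (intro product_sigma_finite.sigma_finite product_sigma_finite.intro sigma_finite_lborel)

lemma lborel_on_component: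
  assumes "X \<in> \<Omega> \<rightarrow>\<^sub>M lborel_on I" "j \<in> I"
  shows "(\<lambda>\<omega>. X \<omega> j) \<in> borel_measurable \<Omega>"
proof -
  have "(\<lambda>x. x j) \<in> lborel_on I \<rightarrow>\<^sub>M lborel"
    unfolding lborel_on_def using assms(2) by (rule measurable_component_singleton)
  from measurable_compose[OF assms(1) this] show ?thesis by simp
qed

lemma channel_measurable:
  assumes "channel W" and Y: "Y \<in> borel_measurable \<Omega>" and X: "X \<in> borel_measurable \<Omega>"
  shows "(\<lambda>\<omega>. W (Y \<omega>) (X \<omega>)) \<in> borel_measurable \<Omega>"
proof -
  have "(\<lambda>(y, x). W y x) \<in> borel_measurable (borel \<Otimes>\<^sub>M borel)"
    using assms(1) by (simp add: channel_def)
  from measurable_compose[OF measurable_Pair[OF Y X] this] show ?thesis by simp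
qed

lemma block_likelihood_measurable:
  assumes "channel W" and "Y \<in> \<Omega> \<rightarrow>\<^sub>M block_space n" and "X \<in> \<Omega> \<rightarrow>\<^sub>M block_space n"
  shows "(\<lambda>\<omega>. block_likelihood n W (Y \<omega>) (X \<omega>)) \<in> borel_measurable \<Omega>"
  unfolding block_likelihood_def
  by (intro borel_measurable_prod channel_measurable[OF assms(1)] lborel_on_component[OF assms(2)]
      lborel_on_component[OF assms(3)])

definition ml_decoder :: "nat \<Rightarrow> (real \<Rightarrow> real \<Rightarrow> real) \<Rightarrow> nat \<Rightarrow> nat \<Rightarrow> (nat \<Rightarrow> nat \<Rightarrow> real) \<Rightarrow> (nat \<Rightarrow> real) \<Rightarrow> nat set" where
  "ml_decoder n W M m c y = top_list {1..M} m (\<lambda>i. block_likelihood n W y (c i))"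

lemma list_code_ml_decoder:
  assumes "channel W" "m \<le> M" and c: "\<And>i. i \<in> {1..M} \<Longrightarrow> c i \<in> space (block_space n)"
  shows "list_code n M m c (ml_decoder n W M m c)"
proof -
  have "{y \<in> space (block_space n). i \<in> ml_decoder n W M m c y} \<in> sets (block_space n)" for i
    unfolding ml_decoder_def
    by (intro top_list_measurable block_likelihood_measurable assms measurable_const) auto
  moreover have "card (ml_decoder n W M m c y) = m" for y
    unfolding ml_decoder_def using assms(2) by (intro card_top_list) auto
  moreover have "ml_decoder n W M m c y \<subseteq> {1..M}" for y
    unfolding ml_decoder_def by (rule top_list_subset)
  ultimately show ?thesis using c by (auto simp: list_code_def)
qed

lemma P_err_avg_le:
  assumes W: "channel W" and code: "list_code n M m c D" and M: "0 < M"
  shows "ennreal (P_err_avg n M W c D) \<le>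
    (\<Sum>i\<in>{1..M}. \<integral>\<^sup>+ y. ennreal (block_likelihood n W y (c i)) * indicator {y. i \<notin> D y} y \<partial>block_space n) / of_nat M"
proof -
  have P: "ennreal (P_err n W c D i) \<le>
      (\<integral>\<^sup>+ y. ennreal (block_likelihood n W y (c i)) * indicator {y. i \<notin> D y} y \<partial>block_space n)"
    if i: "i \<in> {1..M}" for i
  proof -
    let ?E = "{y \<in> space (block_space n). i \<notin> D y}"
    have "?E = space (block_space n) - {y \<in> space (block_space n). i \<in> D y}" by auto
    also have "\<dots> \<in> sets (block_space n)" using code i by (auto simp: list_code_def)
    finally have E: "?E \<in> sets (block_space n)" .
    have ci: "c i \<in> space (block_space n)" using code i by (simp add: list_code_def)
    have meas: "(\<lambda>y. block_likelihood n W y (c i)) \<in> borel_measurable (block_space n)"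
      by (intro block_likelihood_measurable W measurable_const ci) auto
    have "ennreal (P_err n W c D i) \<le> emeasure (output_dist n W (c i)) ?E"
      unfolding P_err_def measure_def by (cases "emeasure (output_dist n W (c i)) ?E") auto
    also have "\<dots> = (\<integral>\<^sup>+ y. ennreal (block_likelihood n W y (c i)) * indicator ?E y \<partial>block_space n)"
      using meas E unfolding output_dist_def block_likelihood_def by (intro emeasure_density) auto
    also have "\<dots> = (\<integral>\<^sup>+ y. ennreal (block_likelihood n W y (c i)) * indicator {y. i \<notin> D y} y \<partial>block_space n)"
      by (intro nn_integral_cong) (auto simp: indicator_def)
    finally show ?thesis .
  qed
  have "ennreal (P_err_avg n M W c D) = (\<Sum>i\<in>{1..M}. ennreal (P_err n W c D i)) / of_nat M"
    unfolding P_err_avg_def using M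
    by (subst divide_ennreal[symmetric])
       (auto simp: P_err_def sum_nonneg ennreal_of_nat_eq_real_of_nat intro!: sum_ennreal[symmetric] arg_cong2[where f="(/)"])
  also have "\<dots> \<le> (\<Sum>i\<in>{1..M}. \<integral>\<^sup>+ y. ennreal (block_likelihood n W y (c i)) * indicator {y. i \<notin> D y} y \<partial>block_space n) / of_nat M"
    by (intro divide_right_mono_ennreal sum_mono P)
  finally show ?thesis .
qed

text \<open>
  The Gallager-type bound for the error contribution of codeword \<open>i\<close> at the output \<open>y\<close>; compare
  \<open>list_error_pointwise\<close>.
\<close>

definition rc_integrand :: "nat \<Rightarrow> (real \<Rightarrow> real \<Rightarrow> real) \<Rightarrow> nat set \<Rightarrow> nat \<Rightarrow> real \<Rightarrow> (nat \<Rightarrow> nat \<Rightarrow> real) \<Rightarrow> (nat \<Rightarrow> real) \<Rightarrow> nat \<Rightarrow> real" where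
  "rc_integrand n W A m \<rho> c y i =
     (let v = (\<lambda>i. block_likelihood n W y (c i) powr (1 / (1 + real m * \<rho>))) in
      v i * (\<Sum>J | J \<subseteq> A - {i} \<and> card J = m. \<Prod>j\<in>J. v j) powr \<rho>)"

lemma rc_integrand_measurable:
  assumes W: "channel W" and A: "finite A" and i: "i \<in> A"
    and Y: "Y \<in> \<Omega> \<rightarrow>\<^sub>M block_space n"
    and X: "\<And>j. j \<in> A \<Longrightarrow> (\<lambda>\<omega>. X \<omega> j) \<in> \<Omega> \<rightarrow>\<^sub>M block_space n"
  shows "(\<lambda>\<omega>. rc_integrand n W A m \<rho> (X \<omega>) (Y \<omega>) i) \<in> borel_measurable \<Omega>"
proof -
  have v: "(\<lambda>\<omega>. block_likelihood n W (Y \<omega>) (X \<omega> j) powr r) \<in> borel_measurable \<Omega>" if "j \<in> A" for j r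
    by (intro powr_real_measurable measurable_const block_likelihood_measurable W Y X that) simp
  show ?thesis
    unfolding rc_integrand_def Let_def
    by (intro borel_measurable_times powr_real_measurable borel_measurable_sum borel_measurable_prod measurable_const v)
       (use i in auto)
qed

lemma ml_error_le_rc:
  assumes W: "channel W" and m: "0 < m" "m \<le> M" and \<rho>: "0 \<le> \<rho>"
    and c: "\<And>i. i \<in> {1..M} \<Longrightarrow> c i \<in> space (block_space n)"
  shows "ennreal (P_err_avg n M W c (ml_decoder n W M m c)) \<le>
    ennreal ((real M - real m) / (real M)\<^sup>2) *
      (\<Sum>i\<in>{1..M}. \<integral>\<^sup>+ y. ennreal (rc_integrand n W {1..M} m \<rho> c y i) \<partial>block_space n)"
proof -
  let ?D = "ml_decoder n W M m c"
  let ?w = "\<lambda>y i. block_likelihood n W y (c i)"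
  let ?t = "\<lambda>y i. rc_integrand n W {1..M} m \<rho> c y i"
  define a where "a = 1 + real m * \<rho>"
  have a: "a > 0" using \<rho> by (simp add: a_def add_pos_nonneg)
  have M: "0 < M" using m by simp
  have code: "list_code n M m c ?D" by (rule list_code_ml_decoder[OF W m(2) c])
  have w_meas: "(\<lambda>y. ?w y i) \<in> borel_measurable (block_space n)" if "i \<in> {1..M}" for i
    by (intro block_likelihood_measurable W measurable_const c that) auto
  have t_meas: "(\<lambda>y. ?t y i) \<in> borel_measurable (block_space n)" if "i \<in> {1..M}" for i
    by (intro rc_integrand_measurable W measurable_const c that) auto
  have t_nonneg: "0 \<le> ?t y i" for y i
    by (auto simp: rc_integrand_def Let_def)
  have ind: "{y \<in> space (block_space n). i \<in> ?D y} \<in> sets (block_space n)" if "i \<in> {1..M}" for i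
    using code that by (auto simp: list_code_def)
  have pw: "(\<Sum>i\<in>{1..M}. ennreal (?w y i) * indicator {y. i \<notin> ?D y} y)
      \<le> ennreal ((real M - real m) / real M) * (\<Sum>i\<in>{1..M}. ennreal (?t y i))" for y
  proof -
    let ?v = "\<lambda>i. ?w y i powr (1 / a)"
    have va: "?v i powr a = ?w y i" for i
      using a block_likelihood_nonneg[OF W] by (simp add: powr_powr)
    have "real (card {1..M}) * (\<Sum>i\<in>{1..M} - ?D y. ?v i powr (1 + real m * \<rho>)) \<le>
        (real (card {1..M}) - real m) *
          (\<Sum>i\<in>{1..M}. ?v i * (\<Sum>J | J \<subseteq> {1..M} - {i} \<and> card J = m. \<Prod>j\<in>J. ?v j) powr \<rho>)"
    proof (rule list_error_pointwise)
      show "?v i \<le> ?v k" if "i \<in> {1..M} - ?D y" "k \<in> ?D y" for i k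
        using top_list_maximal[of "{1..M}" k m "?w y" i] that a block_likelihood_nonneg[OF W]
        by (intro powr_mono2) (auto simp: ml_decoder_def)
    qed (use m \<rho> top_list_subset card_top_list[of "{1..M}" m "?w y"] in \<open>auto simp: ml_decoder_def\<close>)
    then have "real M * (\<Sum>i\<in>{1..M} - ?D y. ?v i powr a) \<le> (real M - real m) * (\<Sum>i\<in>{1..M}. ?t y i)"
      unfolding a_def rc_integrand_def Let_def
      by (simp add: a_def)
    then have "(\<Sum>i\<in>{1..M} - ?D y. ?w y i) \<le> (real M - real m) / real M * (\<Sum>i\<in>{1..M}. ?t y i)"
      using M by (simp add: va field_simps)
    then have "ennreal (\<Sum>i\<in>{1..M} - ?D y. ?w y i) \<le> ennreal ((real M - real m) / real M) * (\<Sum>i\<in>{1..M}. ennreal (?t y i))"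
      using m t_nonneg by (simp add: sum_ennreal ennreal_leI sum_nonneg flip: ennreal_mult)
    moreover have "(\<Sum>i\<in>{1..M}. ennreal (?w y i) * indicator {y. i \<notin> ?D y} y) = ennreal (\<Sum>i\<in>{1..M} - ?D y. ?w y i)"
      using block_likelihood_nonneg[OF W]
      by (subst sum_ennreal[symmetric]) (auto simp: indicator_def sum.If_cases if_distrib Int_def set_diff_eq cong: if_cong)
    ultimately show ?thesis by simp
  qed
  have "(\<Sum>i\<in>{1..M}. \<integral>\<^sup>+ y. ennreal (?w y i) * indicator {y. i \<notin> ?D y} y \<partial>block_space n)
     = (\<integral>\<^sup>+ y. (\<Sum>i\<in>{1..M}. ennreal (?w y i) * indicator {y. i \<notin> ?D y} y) \<partial>block_space n)"
  proof (rule nn_integral_sum[symmetric])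
    fix i assume i: "i \<in> {1..M}"
    let ?E = "space (block_space n) - {y \<in> space (block_space n). i \<in> ?D y}"
    have "(\<lambda>y. ennreal (?w y i) * indicator ?E y) \<in> borel_measurable (block_space n)"
      by (intro borel_measurable_times_ennreal measurable_compose[OF w_meas[OF i] measurable_ennreal]
          borel_measurable_indicator sets.compl_sets ind[OF i])
    moreover have "ennreal (?w y i) * indicator ?E y = ennreal (?w y i) * indicator {y. i \<notin> ?D y} y"
      if "y \<in> space (block_space n)" for y
      using that by (simp add: indicator_def)
    ultimately show "(\<lambda>y. ennreal (?w y i) * indicator {y. i \<notin> ?D y} y) \<in> borel_measurable (block_space n)"
      by (subst (asm) measurable_cong)
  qed
  also have "\<dots> \<le> (\<integral>\<^sup>+ y. ennreal ((real M - real m) / real M) * (\<Sum>i\<in>{1..M}. ennreal (?t y i)) \<partial>block_space n)"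
    by (intro nn_integral_mono pw)
  also have "\<dots> = ennreal ((real M - real m) / real M) * (\<Sum>i\<in>{1..M}. \<integral>\<^sup>+ y. ennreal (?t y i) \<partial>block_space n)"
  proof (subst nn_integral_cmult)
    show "(\<lambda>y. \<Sum>i\<in>{1..M}. ennreal (?t y i)) \<in> borel_measurable (block_space n)"
      using t_meas by (intro borel_measurable_sum measurable_compose[OF _ measurable_ennreal])
    have "(\<integral>\<^sup>+ y. (\<Sum>i\<in>{1..M}. ennreal (?t y i)) \<partial>block_space n) =
        (\<Sum>i\<in>{1..M}. \<integral>\<^sup>+ y. ennreal (?t y i) \<partial>block_space n)"
      using t_meas by (intro nn_integral_sum measurable_compose[OF _ measurable_ennreal])
    then show "ennreal ((real M - real m) / real M) * (\<integral>\<^sup>+ y. (\<Sum>i\<in>{1..M}. ennreal (?t y i)) \<partial>block_space n)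
      = ennreal ((real M - real m) / real M) * (\<Sum>i\<in>{1..M}. \<integral>\<^sup>+ y. ennreal (?t y i) \<partial>block_space n)"
      by (rule arg_cong)
  qed
  finally have "(\<Sum>i\<in>{1..M}. \<integral>\<^sup>+ y. ennreal (?w y i) * indicator {y. i \<notin> ?D y} y \<partial>block_space n) / of_nat M
     \<le> (ennreal ((real M - real m) / real M) * (\<Sum>i\<in>{1..M}. \<integral>\<^sup>+ y. ennreal (?t y i) \<partial>block_space n)) / of_nat M"
    by (rule divide_right_mono_ennreal)
  also have "\<dots> = ennreal ((real M - real m) / (real M)\<^sup>2) * (\<Sum>i\<in>{1..M}. \<integral>\<^sup>+ y. ennreal (?t y i) \<partial>block_space n)"
  proof -
    have "ennreal ((real M - real m) / real M) / of_nat M = ennreal ((real M - real m) / (real M)\<^sup>2)"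
      using M m by (simp add: ennreal_of_nat_eq_real_of_nat divide_ennreal power2_eq_square)
    moreover have "x * y / z = x / z * y" for x y z :: ennreal
      by (metis ennreal_times_divide mult.commute)
    ultimately show ?thesis by (simp only:)
  qed
  finally show ?thesis using P_err_avg_le[OF W code M] by (rule order_trans[rotated])
qed

section \<open>Random codewords on a cost shell\<close>

text \<open>
  A term of either bound is finite only if the mass of the shell is nonzero.
\<close>

locale random_codeword =
  fixes n :: nat and W :: "real \<Rightarrow> real \<Rightarrow> real" and f P :: "real \<Rightarrow> real" and \<delta> s :: real
  assumes W: "channel W" and f [measurable]: "f \<in> borel_measurable borel"
    and P: "prob_density P" and s: "0 \<le> s" and mass_nonzero: "shell_mass n f P \<delta> \<noteq> 0"
begin

definition on_shell :: "(nat \<Rightarrow> real) set" where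
  "on_shell = {x. (\<Sum>i\<in>{1..n}. f (x i)) \<in> {-\<delta>..0}}"

definition codeword_dist :: "(nat \<Rightarrow> real) measure" where
  "codeword_dist = density (block_space n)
     (\<lambda>x. ennreal (\<Prod>i\<in>{1..n}. P (x i)) * indicator on_shell x / shell_mass n f P \<delta>)"

text \<open>
  Not normalised: its integral enters the bounds as it is.
\<close>

definition tilt :: "real \<Rightarrow> real" where
  "tilt x = P x * exp (s * f x)"

definition shell_factor :: ennreal where
  "shell_factor = ennreal (exp (s * \<delta>)) / shell_mass n f P \<delta>"

lemma P_nonneg: "0 \<le> P x"
  using P by (simp add: prob_density_def)

lemma P_measurable [measurable]: "P \<in> borel_measurable borel"
  using P by (simp add: prob_density_def)

lemma tilt_nonneg: "0 \<le> tilt x"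
  by (simp add: tilt_def P_nonneg)

lemma tilt_measurable [measurable]: "tilt \<in> borel_measurable borel"
  unfolding tilt_def by measurable

lemma W_powr_measurable [measurable (raw)]:
  assumes "g \<in> borel_measurable \<Omega>" "h \<in> borel_measurable \<Omega>"
  shows "(\<lambda>\<omega>. W (g \<omega>) (h \<omega>) powr r) \<in> borel_measurable \<Omega>"
  using channel_measurable[OF W assms] by measurable

lemma coord_measurable [measurable]: "j \<in> I \<Longrightarrow> (\<lambda>x. x j) \<in> borel_measurable (lborel_on I)"
  by (rule lborel_on_component) auto

lemma on_shell_measurable [measurable]:
  "(\<lambda>x. indicator on_shell x :: ennreal) \<in> borel_measurable (block_space n)"
proof -
  have "{x \<in> space (block_space n). (\<Sum>i\<in>{1..n}. f (x i)) \<in> {-\<delta>..0}} \<in> sets (block_space n)"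
    by measurable
  then have "(\<lambda>x. indicator {x \<in> space (block_space n). (\<Sum>i\<in>{1..n}. f (x i)) \<in> {-\<delta>..0}} x :: ennreal)
      \<in> borel_measurable (block_space n)"
    by (rule borel_measurable_indicator)
  then show ?thesis
    by (rule measurable_cong[THEN iffD1, rotated]) (auto simp: indicator_def on_shell_def)
qed

lemma shell_mass_eq:
  "shell_mass n f P \<delta> = (\<integral>\<^sup>+ x. ennreal (\<Prod>i\<in>{1..n}. P (x i)) * indicator on_shell x \<partial>block_space n)"
  by (simp add: shell_mass_def on_shell_def)

lemma shell_mass_le_1: "shell_mass n f P \<delta> \<le> 1"
proof -
  interpret product_sigma_finite "\<lambda>_::nat. lborel :: real measure"
    by (intro product_sigma_finite.intro sigma_finite_lborel)
  have "shell_mass n f P \<delta> \<le> (\<integral>\<^sup>+ x. (\<Prod>i\<in>{1..n}. ennreal (P (x i))) \<partial>block_space n)"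
    unfolding shell_mass_eq
    by (intro nn_integral_mono) (auto simp: indicator_def prod_ennreal P_nonneg)
  also have "\<dots> = (\<Prod>i\<in>{1..n}. \<integral>\<^sup>+ x. ennreal (P x) \<partial>lborel)"
    unfolding lborel_on_def by (intro product_nn_integral_prod) auto
  also have "\<dots> = 1" using P by (simp add: prob_density_def)
  finally show ?thesis .
qed

lemma shell_mass_finite: "shell_mass n f P \<delta> < \<infinity>"
  using shell_mass_le_1 by (rule le_less_trans) simp

lemma codeword_density_measurable [measurable]:
  "(\<lambda>x. ennreal (\<Prod>i\<in>{1..n}. P (x i)) * indicator on_shell x / shell_mass n f P \<delta>)
    \<in> borel_measurable (block_space n)"
  by measurable

lemma sets_codeword_dist [measurable_cong, simp]: "sets codeword_dist = sets (block_space n)"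
  by (simp add: codeword_dist_def)

lemma space_codeword_dist [simp]: "space codeword_dist = space (block_space n)"
  by (simp add: codeword_dist_def)

lemma prob_space_codeword_dist: "prob_space codeword_dist"
proof
  have "emeasure codeword_dist (space codeword_dist) =
    (\<integral>\<^sup>+ x. ennreal (\<Prod>i\<in>{1..n}. P (x i)) * indicator on_shell x / shell_mass n f P \<delta> \<partial>block_space n)"
    unfolding codeword_dist_def space_density
    by (subst emeasure_density[OF codeword_density_measurable sets.top], rule nn_integral_cong) simp
  also have "\<dots> = shell_mass n f P \<delta> / shell_mass n f P \<delta>"
    unfolding shell_mass_eq by (rule nn_integral_divide) measurable
  also have "\<dots> = 1"
    using mass_nonzero shell_mass_finite by (intro ennreal_divide_self) auto
  finally show "emeasure codeword_dist (space codeword_dist) = 1" .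
qed

lemma AE_codeword_on_shell: "AE x in codeword_dist. x \<in> on_shell"
  unfolding codeword_dist_def
  by (subst AE_density, rule codeword_density_measurable) (auto intro!: AE_I2 simp: indicator_def split: if_splits)

text \<open>
  On the shell the total cost is at least \<open>-\<delta>\<close>, so \<open>e^(s (\<delta> + total cost)) \<ge> 1\<close> may be inserted in
  place of the indicator, which does not factor over the coordinates.
\<close>

lemma nn_integral_codeword_le:
  assumes [measurable]: "\<psi> \<in> borel_measurable (block_space n)"
  shows "(\<integral>\<^sup>+ x. \<psi> x \<partial>codeword_dist) \<le>
    shell_factor * (\<integral>\<^sup>+ x. ennreal (\<Prod>j\<in>{1..n}. tilt (x j)) * \<psi> x \<partial>block_space n)"
proof -
  have "(\<integral>\<^sup>+ x. \<psi> x \<partial>codeword_dist) = (\<integral>\<^sup>+ x. ennreal (\<Prod>i\<in>{1..n}. P (x i)) * indicator on_shell x / shell_mass n f P \<delta> * \<psi> x \<partial>block_space n)"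
    unfolding codeword_dist_def by (rule nn_integral_density) measurable
  also have "\<dots> \<le> (\<integral>\<^sup>+ x. shell_factor * (ennreal (\<Prod>j\<in>{1..n}. tilt (x j)) * \<psi> x) \<partial>block_space n)"
  proof (rule nn_integral_mono)
    fix x
    have "ennreal (\<Prod>i\<in>{1..n}. P (x i)) * indicator on_shell x \<le>
        ennreal (exp (s * \<delta>)) * ennreal (\<Prod>j\<in>{1..n}. tilt (x j))"
    proof (cases "x \<in> on_shell")
      case True
      then have "- \<delta> \<le> (\<Sum>i\<in>{1..n}. f (x i))" by (simp add: on_shell_def)
      then have "s * (- \<delta>) \<le> s * (\<Sum>i\<in>{1..n}. f (x i))" using s by (rule mult_left_mono)
      then have "1 \<le> exp (s * \<delta> + s * (\<Sum>i\<in>{1..n}. f (x i)))" by simp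
      then have "1 * (\<Prod>i\<in>{1..n}. P (x i)) \<le> exp (s * \<delta> + s * (\<Sum>i\<in>{1..n}. f (x i))) * (\<Prod>i\<in>{1..n}. P (x i))"
        by (intro mult_right_mono prod_nonneg) (auto simp: P_nonneg)
      also have "\<dots> = exp (s * \<delta>) * (\<Prod>j\<in>{1..n}. tilt (x j))"
        by (simp add: tilt_def exp_add exp_sum sum_distrib_left prod.distrib)
      finally show ?thesis using True
        by (simp add: ennreal_leI flip: ennreal_mult' )
    qed simp
    then have "ennreal (\<Prod>i\<in>{1..n}. P (x i)) * indicator on_shell x / shell_mass n f P \<delta> * \<psi> x \<le>
      ennreal (exp (s * \<delta>)) * ennreal (\<Prod>j\<in>{1..n}. tilt (x j)) / shell_mass n f P \<delta> * \<psi> x"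
      by (intro mult_right_mono divide_right_mono_ennreal) auto
    also have "\<dots> = shell_factor * (ennreal (\<Prod>j\<in>{1..n}. tilt (x j)) * \<psi> x)"
      by (simp add: shell_factor_def divide_ennreal_def mult_ac)
    finally show "ennreal (\<Prod>i\<in>{1..n}. P (x i)) * indicator on_shell x / shell_mass n f P \<delta> * \<psi> x \<le>
      shell_factor * (ennreal (\<Prod>j\<in>{1..n}. tilt (x j)) * \<psi> x)" .
  qed
  also have "\<dots> = shell_factor * (\<integral>\<^sup>+ x. ennreal (\<Prod>j\<in>{1..n}. tilt (x j)) * \<psi> x \<partial>block_space n)"
    by (rule nn_integral_cmult) measurable
  finally show ?thesis .
qed

definition codebook_dist :: "nat set \<Rightarrow> (nat \<Rightarrow> nat \<Rightarrow> real) measure" where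
  "codebook_dist A = (\<Pi>\<^sub>M i\<in>A. codeword_dist)"

lemma prob_space_codebook_dist: "prob_space (codebook_dist A)"
  unfolding codebook_dist_def by (intro prob_space_PiM prob_space_codeword_dist)

lemma codeword_measurable: "i \<in> A \<Longrightarrow> (\<lambda>c. c i) \<in> codebook_dist A \<rightarrow>\<^sub>M block_space n"
proof -
  assume "i \<in> A"
  then have "(\<lambda>c. c i) \<in> codebook_dist A \<rightarrow>\<^sub>M codeword_dist"
    unfolding codebook_dist_def by (rule measurable_component_singleton)
  then show ?thesis by (simp cong: measurable_cong_sets)
qed

text \<open>
  A function on a probability space cannot exceed its mean almost everywhere; the cost constraint holds
  almost everywhere, so both can be had at one codebook.
\<close>

lemma exists_codebook_le_mean:
  assumes A: "finite A" and F [measurable]: "F \<in> borel_measurable (codebook_dist A)"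
    and le: "(\<integral>\<^sup>+ c. F c \<partial>codebook_dist A) \<le> b" and b: "b < \<infinity>"
  obtains c where "\<And>i. i \<in> A \<Longrightarrow> c i \<in> space (block_space n)"
    and "\<And>i. i \<in> A \<Longrightarrow> (\<Sum>j\<in>{1..n}. f (c i j)) \<le> 0" and "F c \<le> b"
proof -
  interpret C: prob_space "codebook_dist A" by (rule prob_space_codebook_dist)
  have shell: "AE c in codebook_dist A. \<forall>i\<in>A. c i \<in> on_shell"
    unfolding codebook_dist_def
    by (intro AE_finite_allI A AE_PiM_component prob_space_codeword_dist AE_codeword_on_shell)
  have not_above: "\<not> (AE c in codebook_dist A. b < F c)"
  proof
    assume gt: "AE c in codebook_dist A. b < F c"
    have "(\<integral>\<^sup>+ c. b \<partial>codebook_dist A) < (\<integral>\<^sup>+ c. F c \<partial>codebook_dist A)"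
    proof (rule nn_integral_less)
      show "(\<integral>\<^sup>+ c. b \<partial>codebook_dist A) \<noteq> \<infinity>" using b by (simp add: C.emeasure_space_1)
      show "AE c in codebook_dist A. b \<le> F c" using gt by (rule eventually_mono) simp
      show "\<not> (AE c in codebook_dist A. F c \<le> b)"
      proof
        assume "AE c in codebook_dist A. F c \<le> b"
        with gt have "AE c in codebook_dist A. False" by eventually_elim simp
        then show False using C.AE_False by simp
      qed
    qed simp_all
    then show False using le by (simp add: C.emeasure_space_1)
  qed
  have "\<exists>c\<in>space (codebook_dist A). (\<forall>i\<in>A. c i \<in> on_shell) \<and> F c \<le> b"
  proof (rule ccontr)
    assume none: "\<not> ?thesis"
    have "AE c in codebook_dist A. b < F c"
      using shell AE_space by eventually_elim (use none in \<open>auto simp: not_le\<close>)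
    with not_above show False by contradiction
  qed
  then obtain c where c: "c \<in> space (codebook_dist A)" "\<forall>i\<in>A. c i \<in> on_shell" "F c \<le> b" by auto
  have "c i \<in> space (block_space n)" if "i \<in> A" for i
    using measurable_space[OF codeword_measurable[OF that] c(1)] .
  then show thesis using c(2,3) by (intro that[of c]) (auto simp: on_shell_def)
qed

end

section \<open>The random coding average\<close>

context random_codeword
begin

lemma likelihood_powr_measurable:
  assumes "y \<in> space (block_space n)"
  shows "(\<lambda>x. block_likelihood n W y x powr r) \<in> borel_measurable (block_space n)"
  by (intro powr_real_measurable measurable_const block_likelihood_measurable W assms) auto

text \<open>
  Jensen's inequality with respect to the codewords other than \<open>i\<close>.  After the tangent bound only
  means of products of distinct \<open>v (c j)\<close> are left, and these are powers of the mean \<open>G\<close> of a single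
  factor.
\<close>

lemma rc_integrand_mean_le:
  assumes A: "finite A" and i: "i \<in> A" and m: "0 < m" and \<rho>: "0 \<le> \<rho>" "\<rho> \<le> 1"
    and y: "y \<in> space (block_space n)"
  defines "a \<equiv> 1 + real m * \<rho>"
  shows "(\<integral>\<^sup>+ c. ennreal (rc_integrand n W A m \<rho> c y i) \<partial>codebook_dist A) \<le>
    ennreal (real (card A) powr (real m * \<rho>)) *
      epowr (\<integral>\<^sup>+ x. ennreal (block_likelihood n W y x powr (1 / a)) \<partial>codeword_dist) a"
proof -
  define v where "v = (\<lambda>x. block_likelihood n W y x powr (1 / a))"
  define e where "e = (\<lambda>c. \<Sum>J | J \<subseteq> A - {i} \<and> card J = m. \<Prod>j\<in>J. v (c j))"
  let ?JJ = "{J. J \<subseteq> A - {i} \<and> card J = m}"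
  have a: "0 < a" using \<rho> by (simp add: a_def add_pos_nonneg)
  have cardA: "0 < real (card A)" using A i by (auto simp: card_gt_0_iff)
  have finJJ: "finite ?JJ" using A by simp
  have v_meas [measurable]: "v \<in> borel_measurable (block_space n)"
    unfolding v_def by (rule likelihood_powr_measurable[OF y])
  have vc_meas [measurable]: "(\<lambda>c. v (c j)) \<in> borel_measurable (codebook_dist A)" if "j \<in> A" for j
    by (rule measurable_compose[OF codeword_measurable[OF that] v_meas])
  have v_nonneg: "0 \<le> v x" for x by (simp add: v_def)
  have e_nonneg: "0 \<le> e c" for c by (auto simp: e_def v_nonneg intro!: sum_nonneg prod_nonneg)
  have rc: "rc_integrand n W A m \<rho> c y i = v (c i) * e c powr \<rho>" for c
    by (simp add: rc_integrand_def e_def v_def a_def Let_def)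
  define G where "G = (\<integral>\<^sup>+ x. ennreal (v x) \<partial>codeword_dist)"
  have mean_prod: "(\<integral>\<^sup>+ c. ennreal (\<Prod>j\<in>S. v (c j)) \<partial>codebook_dist A) = G ^ card S" if "S \<subseteq> A" for S
    using nn_integral_PiM_iid_prod[OF prob_space_codeword_dist A that, of "\<lambda>x. ennreal (v x)"]
    by (simp add: prod_ennreal v_nonneg G_def codebook_dist_def)
  have mean_v: "(\<integral>\<^sup>+ c. ennreal (v (c i)) \<partial>codebook_dist A) = G"
    using mean_prod[of "{i}"] i by simp
  have "(\<integral>\<^sup>+ c. ennreal (v (c i) * e c powr \<rho>) \<partial>codebook_dist A) \<le>
      ennreal (real (card A) powr (real m * \<rho>)) * epowr G a"
  proof (cases G rule: ennreal_cases)
    case top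
    then show ?thesis using cardA by (simp add: ennreal_mult_top)
  next
    case (real \<gamma>)
    show ?thesis
    proof (cases "\<gamma> = 0")
      case True
      then have "AE c in codebook_dist A. ennreal (v (c i)) = 0"
        using mean_v real i by (subst nn_integral_0_iff_AE[symmetric]) auto
      then have "AE c in codebook_dist A. ennreal (v (c i) * e c powr \<rho>) = 0"
      proof eventually_elim
        case (elim c)
        then have "v (c i) = 0" using v_nonneg[of "c i"] by (simp add: ennreal_eq_0_iff)
        then show ?case by simp
      qed
      then have "(\<integral>\<^sup>+ c. ennreal (v (c i) * e c powr \<rho>) \<partial>codebook_dist A) = 0"
        by (simp add: nn_integral_cong_AE)
      then show ?thesis by simp
    next
      case False
      then have \<gamma>: "0 < \<gamma>" using real by simp
      \<comment> \<open>The tangent point is a bound for the mean of \<open>e\<close> rather than the mean itself, which is 0 if \<open>A\<close>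
        has only \<open>m\<close> elements.\<close>
      define \<mu> where "\<mu> = (real (card A) * \<gamma>) ^ m"
      have \<mu>: "0 < \<mu>" using \<gamma> cardA by (simp add: \<mu>_def)
      let ?c0 = "(1 - \<rho>) * \<mu> powr \<rho>" and ?c1 = "\<rho> * \<mu> powr (\<rho> - 1)"
      have ve: "ennreal (v (c i) * e c) = (\<Sum>J\<in>?JJ. ennreal (\<Prod>j\<in>insert i J. v (c j)))" for c
      proof -
        have "v (c i) * e c = (\<Sum>J\<in>?JJ. \<Prod>j\<in>insert i J. v (c j))"
          unfolding e_def sum_distrib_left
          using A by (intro sum.cong refl, subst prod.insert) (auto dest: finite_subset)
        then show ?thesis by (simp add: sum_ennreal prod_nonneg v_nonneg)
      qed
      have ve_meas: "(\<lambda>c. ennreal (\<Prod>j\<in>insert i J. v (c j))) \<in> borel_measurable (codebook_dist A)" if "J \<in> ?JJ" for J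
        using that i by (intro measurable_compose[OF borel_measurable_prod measurable_ennreal] vc_meas) auto
      have "card ?JJ = (card A - 1) choose m"
        using A i by (simp add: n_subsets)
      also have "\<dots> \<le> card A ^ m"
        by (rule order_trans[OF choose_le_power power_mono]) auto
      finally have card_JJ: "real (card ?JJ) \<le> real (card A) ^ m"
        by (simp flip: of_nat_power)
      have "(\<integral>\<^sup>+ c. ennreal (v (c i) * e c) \<partial>codebook_dist A) = (\<Sum>J\<in>?JJ. G ^ Suc m)"
        unfolding ve
      proof (subst nn_integral_sum)
        show "(\<Sum>J\<in>?JJ. \<integral>\<^sup>+ c. ennreal (\<Prod>j\<in>insert i J. v (c j)) \<partial>codebook_dist A) = (\<Sum>J\<in>?JJ. G ^ Suc m)"
        proof (rule sum.cong[OF refl])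
          fix J assume J: "J \<in> ?JJ"
          then have "finite J" "i \<notin> J" using A by (auto dest: finite_subset)
          then show "(\<integral>\<^sup>+ c. ennreal (\<Prod>j\<in>insert i J. v (c j)) \<partial>codebook_dist A) = G ^ Suc m"
            using J i mean_prod[of "insert i J"] by auto
        qed
      qed (rule ve_meas)
      also have "\<dots> = ennreal (real (card ?JJ) * \<gamma> ^ Suc m)"
        using real by (simp add: ennreal_power ennreal_of_nat_eq_real_of_nat ennreal_mult del: power_Suc)
      also have "\<dots> \<le> ennreal (\<mu> * \<gamma>)"
        using card_JJ \<gamma> by (intro ennreal_leI) (simp add: \<mu>_def power_mult_distrib mult_ac mult_left_mono)
      finally have mean_ve: "(\<integral>\<^sup>+ c. ennreal (v (c i) * e c) \<partial>codebook_dist A) \<le> ennreal (\<mu> * \<gamma>)" .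
      have "(\<integral>\<^sup>+ c. ennreal (v (c i) * e c powr \<rho>) \<partial>codebook_dist A) \<le>
          (\<integral>\<^sup>+ c. ennreal ?c0 * ennreal (v (c i)) + ennreal ?c1 * ennreal (v (c i) * e c) \<partial>codebook_dist A)"
      proof (rule nn_integral_mono)
        fix c
        have "v (c i) * e c powr \<rho> \<le> v (c i) * (?c0 + ?c1 * e c)"
          using powr_le_tangent[OF e_nonneg \<mu> \<rho>] v_nonneg by (intro mult_left_mono) auto
        also have "\<dots> = ?c0 * v (c i) + ?c1 * (v (c i) * e c)" by (simp add: algebra_simps)
        finally have "ennreal (v (c i) * e c powr \<rho>) \<le> ennreal (?c0 * v (c i) + ?c1 * (v (c i) * e c))"
          by (rule ennreal_leI)
        also have "\<dots> = ennreal ?c0 * ennreal (v (c i)) + ennreal ?c1 * ennreal (v (c i) * e c)"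
          using \<rho> v_nonneg e_nonneg by (subst ennreal_plus) (auto simp: ennreal_mult)
        finally show "ennreal (v (c i) * e c powr \<rho>) \<le>
          ennreal ?c0 * ennreal (v (c i)) + ennreal ?c1 * ennreal (v (c i) * e c)" .
      qed
      also have "\<dots> = ennreal ?c0 * G + ennreal ?c1 * (\<integral>\<^sup>+ c. ennreal (v (c i) * e c) \<partial>codebook_dist A)"
      proof -
        have m1: "(\<lambda>c. ennreal (v (c i))) \<in> borel_measurable (codebook_dist A)"
          by (rule measurable_compose[OF vc_meas[OF i] measurable_ennreal])
        have m2: "(\<lambda>c. ennreal (v (c i) * e c)) \<in> borel_measurable (codebook_dist A)"
          unfolding ve by (intro borel_measurable_sum ve_meas)
        show ?thesis
          using m1 m2 by (simp add: nn_integral_add nn_integral_cmult mean_v)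
      qed
      also have "\<dots> \<le> ennreal ?c0 * ennreal \<gamma> + ennreal ?c1 * ennreal (\<mu> * \<gamma>)"
        unfolding real(2) by (intro add_mono mult_left_mono mean_ve) auto
      also have "\<dots> = ennreal (?c0 * \<gamma> + ?c1 * (\<mu> * \<gamma>))"
        using \<rho> \<gamma> \<mu> by (subst ennreal_plus) (auto simp: ennreal_mult)
      also have "?c0 * \<gamma> + ?c1 * (\<mu> * \<gamma>) = \<mu> powr \<rho> * \<gamma>"
        using \<mu> by (simp add: powr_diff field_simps)
      also have "\<dots> = real (card A) powr (real m * \<rho>) * \<gamma> powr a"
        using \<gamma> cardA
        by (simp add: \<mu>_def a_def powr_add powr_mult power_mult_distrib powr_powr flip: powr_realpow)
      also have "ennreal \<dots> = ennreal (real (card A) powr (real m * \<rho>)) * epowr G a"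
        using real by (simp add: epowr_ennreal ennreal_mult)
      finally show ?thesis .
    qed
  qed
  then show ?thesis by (simp add: rc G_def v_def)
qed

lemma tilted_output_integral:
  assumes a: "0 < a"
  shows "(\<integral>\<^sup>+ y. epowr (\<integral>\<^sup>+ x. ennreal (block_likelihood n W y x powr (1 / a)) \<partial>codeword_dist) a \<partial>block_space n)
    \<le> epowr shell_factor a *
      (\<integral>\<^sup>+ y. epowr (\<integral>\<^sup>+ x. ennreal (P x * exp (s * f x) * W y x powr (1 / a)) \<partial>lborel) a \<partial>lborel) ^ n"
proof -
  interpret product_sigma_finite "\<lambda>_::nat. lborel :: real measure"
    by (intro product_sigma_finite.intro sigma_finite_lborel)
  define h where "h = (\<lambda>y. \<integral>\<^sup>+ x. ennreal (P x * exp (s * f x) * W y x powr (1 / a)) \<partial>lborel)"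
  have h_meas [measurable]: "h \<in> borel_measurable borel"
    unfolding h_def by measurable
  have single: "(\<integral>\<^sup>+ x. ennreal (block_likelihood n W y x powr (1 / a)) \<partial>codeword_dist) \<le>
      shell_factor * (\<Prod>j\<in>{1..n}. h (y j))" if y: "y \<in> space (block_space n)" for y
  proof -
    have "(\<lambda>x. ennreal (block_likelihood n W y x powr (1 / a))) \<in> borel_measurable (block_space n)"
      by (rule measurable_compose[OF likelihood_powr_measurable[OF y] measurable_ennreal])
    then have "(\<integral>\<^sup>+ x. ennreal (block_likelihood n W y x powr (1 / a)) \<partial>codeword_dist) \<le>
        shell_factor * (\<integral>\<^sup>+ x. ennreal (\<Prod>j\<in>{1..n}. tilt (x j)) *
           ennreal (block_likelihood n W y x powr (1 / a)) \<partial>block_space n)"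
      by (rule nn_integral_codeword_le)
    also have "(\<integral>\<^sup>+ x. ennreal (\<Prod>j\<in>{1..n}. tilt (x j)) *
           ennreal (block_likelihood n W y x powr (1 / a)) \<partial>block_space n) =
        (\<integral>\<^sup>+ x. (\<Prod>j\<in>{1..n}. ennreal (tilt (x j) * W (y j) (x j) powr (1 / a))) \<partial>block_space n)"
      by (intro nn_integral_cong)
        (simp add: block_likelihood_powr[OF W] prod_ennreal tilt_nonneg prod_nonneg prod.distrib flip: ennreal_mult)
    also have "\<dots> = (\<Prod>j\<in>{1..n}. h (y j))"
      unfolding lborel_on_def h_def
      by (subst product_nn_integral_prod) (auto simp: tilt_def)
    finally show ?thesis .
  qed
  have "(\<integral>\<^sup>+ y. epowr (\<integral>\<^sup>+ x. ennreal (block_likelihood n W y x powr (1 / a)) \<partial>codeword_dist) a \<partial>block_space n)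
      \<le> (\<integral>\<^sup>+ y. epowr shell_factor a * (\<Prod>j\<in>{1..n}. epowr (h (y j)) a) \<partial>block_space n)"
  proof (rule nn_integral_mono)
    fix y assume "y \<in> space (block_space n)"
    from epowr_mono[OF single[OF this], of a] a
    show "epowr (\<integral>\<^sup>+ x. ennreal (block_likelihood n W y x powr (1 / a)) \<partial>codeword_dist) a \<le>
      epowr shell_factor a * (\<Prod>j\<in>{1..n}. epowr (h (y j)) a)"
      by (simp add: epowr_mult epowr_prod)
  qed
  also have "\<dots> = epowr shell_factor a * (\<integral>\<^sup>+ y. (\<Prod>j\<in>{1..n}. epowr (h (y j)) a) \<partial>block_space n)"
    by (intro nn_integral_cmult borel_measurable_prod_ennreal measurable_epowr
        measurable_compose[OF coord_measurable h_meas])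
  also have "(\<integral>\<^sup>+ y. (\<Prod>j\<in>{1..n}. epowr (h (y j)) a) \<partial>block_space n) = (\<integral>\<^sup>+ y. epowr (h y) a \<partial>lborel) ^ n"
    unfolding lborel_on_def by (subst product_nn_integral_prod) auto
  finally show ?thesis unfolding h_def .
qed

lemma rc_mean_le:
  assumes A: "finite A" and m: "0 < m" and \<rho>: "0 \<le> \<rho>" "\<rho> \<le> 1"
  defines "a \<equiv> 1 + real m * \<rho>"
  shows "(\<integral>\<^sup>+ c. (\<Sum>i\<in>A. \<integral>\<^sup>+ y. ennreal (rc_integrand n W A m \<rho> c y i) \<partial>block_space n) \<partial>codebook_dist A) \<le>
    of_nat (card A) * (ennreal (real (card A) powr (real m * \<rho>)) * epowr shell_factor a *
      (\<integral>\<^sup>+ y. epowr (\<integral>\<^sup>+ x. ennreal (P x * exp (s * f x) * W y x powr (1 / a)) \<partial>lborel) a \<partial>lborel) ^ n)"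
    (is "_ \<le> of_nat (card A) * (?k * _ * ?I)")
proof -
  have a: "0 < a" using \<rho> by (simp add: a_def add_pos_nonneg)
  interpret C: prob_space "codebook_dist A" by (rule prob_space_codebook_dist)
  interpret N: sigma_finite_measure "block_space n" by (rule sigma_finite_lborel_on) simp
  interpret pair_sigma_finite "codebook_dist A" "block_space n" ..
  let ?t = "\<lambda>i c y. ennreal (rc_integrand n W A m \<rho> c y i)"
  let ?G = "\<lambda>y. \<integral>\<^sup>+ x. ennreal (block_likelihood n W y x powr (1 / a)) \<partial>codeword_dist"
  have t_meas: "(\<lambda>(c, y). ?t i c y) \<in> borel_measurable (codebook_dist A \<Otimes>\<^sub>M block_space n)" if i: "i \<in> A" for i
  proof -
    have "(\<lambda>p. rc_integrand n W A m \<rho> (fst p) (snd p) i) \<in> borel_measurable (codebook_dist A \<Otimes>\<^sub>M block_space n)"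
      by (intro rc_integrand_measurable W A i measurable_snd measurable_compose[OF measurable_fst codeword_measurable])
    then show ?thesis by (simp add: case_prod_beta')
  qed
  have mean: "(\<integral>\<^sup>+ c. (\<integral>\<^sup>+ y. ?t i c y \<partial>block_space n) \<partial>codebook_dist A) \<le> ?k * (epowr shell_factor a * ?I)"
    if i: "i \<in> A" for i
  proof -
    have "(\<integral>\<^sup>+ c. (\<integral>\<^sup>+ y. ?t i c y \<partial>block_space n) \<partial>codebook_dist A) =
        (\<integral>\<^sup>+ y. (\<integral>\<^sup>+ c. ?t i c y \<partial>codebook_dist A) \<partial>block_space n)"
      by (rule Fubini'[OF t_meas[OF i], symmetric])
    also have "\<dots> \<le> (\<integral>\<^sup>+ y. ?k * epowr (?G y) a \<partial>block_space n)"
      using rc_integrand_mean_le[OF A i m \<rho>] unfolding a_def by (intro nn_integral_mono) auto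
    also have "\<dots> = ?k * (\<integral>\<^sup>+ y. epowr (?G y) a \<partial>block_space n)"
    proof (rule nn_integral_cmult)
      interpret Q: prob_space codeword_dist by (rule prob_space_codeword_dist)
      have "(\<lambda>p. block_likelihood n W (fst p) (snd p) powr (1 / a)) \<in> borel_measurable (block_space n \<Otimes>\<^sub>M codeword_dist)"
      proof (intro powr_real_measurable block_likelihood_measurable W measurable_fst)
        show "snd \<in> block_space n \<Otimes>\<^sub>M codeword_dist \<rightarrow>\<^sub>M block_space n"
          using measurable_snd[of "block_space n" codeword_dist] by (simp cong: measurable_cong_sets)
      qed simp
      then have "(\<lambda>(y, x). ennreal (block_likelihood n W y x powr (1 / a))) \<in> borel_measurable (block_space n \<Otimes>\<^sub>M codeword_dist)"
        by (simp add: case_prod_beta')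
      from Q.borel_measurable_nn_integral[OF this]
      show "(\<lambda>y. epowr (?G y) a) \<in> borel_measurable (block_space n)"
        by (rule measurable_epowr)
    qed
    also have "\<dots> \<le> ?k * (epowr shell_factor a * ?I)"
      by (intro mult_left_mono tilted_output_integral a) auto
    finally show ?thesis .
  qed
  have "(\<integral>\<^sup>+ c. (\<Sum>i\<in>A. \<integral>\<^sup>+ y. ?t i c y \<partial>block_space n) \<partial>codebook_dist A) =
      (\<Sum>i\<in>A. \<integral>\<^sup>+ c. (\<integral>\<^sup>+ y. ?t i c y \<partial>block_space n) \<partial>codebook_dist A)"
    by (intro nn_integral_sum N.borel_measurable_nn_integral t_meas)
  also have "\<dots> \<le> (\<Sum>i\<in>A. ?k * (epowr shell_factor a * ?I))"
    by (intro sum_mono mean)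
  finally show ?thesis by (simp add: mult_ac)
qed

lemma exists_random_code:
  assumes m: "0 < m" "m \<le> M" and \<rho>: "0 \<le> \<rho>" "\<rho> \<le> 1"
    and I: "(\<integral>\<^sup>+ y. epowr (\<integral>\<^sup>+ x. ennreal (P x * exp (s * f x) * W y x powr (1 / (1 + real m * \<rho>))) \<partial>lborel)
        (1 + real m * \<rho>) \<partial>lborel) = I"
    and t: "t = ennreal (real M powr (real m * \<rho>)) * epowr shell_factor (1 + real m * \<rho>) * I ^ n" "t < \<infinity>"
  obtains c D where "list_code n M m c D" "satisfies_constraints n M f c"
    "ennreal (P_err_avg n M W c D) \<le> ennreal (1 - 1 / (2 * real M)) * t"
proof -
  let ?F = "\<lambda>c. \<Sum>i\<in>{1..M}. \<integral>\<^sup>+ y. ennreal (rc_integrand n W {1..M} m \<rho> c y i) \<partial>block_space n"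
  have F_meas: "?F \<in> borel_measurable (codebook_dist {1..M})"
  proof (rule borel_measurable_sum)
    fix i assume i: "i \<in> {1..M}"
    interpret N: sigma_finite_measure "block_space n" by (rule sigma_finite_lborel_on) simp
    have "(\<lambda>p. rc_integrand n W {1..M} m \<rho> (fst p) (snd p) i) \<in> borel_measurable (codebook_dist {1..M} \<Otimes>\<^sub>M block_space n)"
      by (intro rc_integrand_measurable W finite_atLeastAtMost i measurable_snd measurable_compose[OF measurable_fst codeword_measurable])
    then have "(\<lambda>(c, y). ennreal (rc_integrand n W {1..M} m \<rho> c y i)) \<in> borel_measurable (codebook_dist {1..M} \<Otimes>\<^sub>M block_space n)"
      by (simp add: case_prod_beta')
    then show "(\<lambda>c. \<integral>\<^sup>+ y. ennreal (rc_integrand n W {1..M} m \<rho> c y i) \<partial>block_space n) \<in> borel_measurable (codebook_dist {1..M})"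
      by (rule N.borel_measurable_nn_integral)
  qed
  have "(\<integral>\<^sup>+ c. ?F c \<partial>codebook_dist {1..M}) \<le> of_nat M * t"
    using rc_mean_le[of "{1..M}" m \<rho>] m \<rho> I t(1) by simp
  moreover have "of_nat M * t < \<infinity>" using t(2) by (simp add: ennreal_mult_less_top of_nat_less_top)
  ultimately obtain c where c: "\<And>i. i \<in> {1..M} \<Longrightarrow> c i \<in> space (block_space n)"
      "\<And>i. i \<in> {1..M} \<Longrightarrow> (\<Sum>j\<in>{1..n}. f (c i j)) \<le> 0" "?F c \<le> of_nat M * t"
    by (rule exists_codebook_le_mean[OF finite_atLeastAtMost F_meas]) blast
  have "ennreal (P_err_avg n M W c (ml_decoder n W M m c)) \<le> ennreal ((real M - real m) / (real M)\<^sup>2) * ?F c"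
    by (rule ml_error_le_rc[OF W m \<rho>(1) c(1)])
  also have "\<dots> \<le> ennreal ((real M - real m) / (real M)\<^sup>2) * (of_nat M * t)"
    by (intro mult_left_mono c(3)) simp
  also have "\<dots> = ennreal ((real M - real m) / (real M)\<^sup>2 * real M) * t"
    unfolding ennreal_of_nat_eq_real_of_nat mult.assoc[symmetric]
    using m by (subst ennreal_mult[symmetric]) auto
  also have "\<dots> \<le> ennreal (1 - 1 / (2 * real M)) * t"
    using m by (intro mult_right_mono ennreal_leI) (auto simp: power2_eq_square field_simps)
  finally show thesis
    using c(2) by (intro that[OF list_code_ml_decoder[OF W m(2) c(1)]]) (auto simp: satisfies_constraints_def)
qed

end

section \<open>Affinities and the union bound\<close>

text \<open>
  For \<open>r = 1 / card S\<close> this is the Bhattacharyya affinity of the output densities of the codewords in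
  \<open>S\<close>.
\<close>

definition affinity :: "nat \<Rightarrow> (real \<Rightarrow> real \<Rightarrow> real) \<Rightarrow> real \<Rightarrow> nat set \<Rightarrow> (nat \<Rightarrow> nat \<Rightarrow> real) \<Rightarrow> ennreal" where
  "affinity n W r S c =
     (\<integral>\<^sup>+ y. ennreal (\<Prod>k\<in>S. block_likelihood n W y (c k) powr r) \<partial>block_space n)"

text \<open>
  An erroneous list \<open>J\<close> consists of \<open>m\<close> codewords with at least the likelihood of \<open>c i\<close>, so that
  likelihood is at most the geometric mean over \<open>insert i J\<close>.  The sum over all \<open>J\<close> removes the
  dependence of the list on \<open>y\<close>.
\<close>

lemma ml_error_le_affinity:
  assumes W: "channel W" and m: "0 < m" "m \<le> M"
    and c: "\<And>i. i \<in> {1..M} \<Longrightarrow> c i \<in> space (block_space n)" and i: "i \<in> {1..M}"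
  shows "(\<integral>\<^sup>+ y. ennreal (block_likelihood n W y (c i)) * indicator {y. i \<notin> ml_decoder n W M m c y} y \<partial>block_space n)
    \<le> (\<Sum>J | J \<subseteq> {1..M} - {i} \<and> card J = m. affinity n W (1 / real (Suc m)) (insert i J) c)"
proof -
  let ?D = "ml_decoder n W M m c"
  let ?w = "\<lambda>y i. block_likelihood n W y (c i)"
  let ?r = "1 / real (Suc m)"
  let ?JJ = "{J. J \<subseteq> {1..M} - {i} \<and> card J = m}"
  have w_meas: "(\<lambda>y. ?w y i) \<in> borel_measurable (block_space n)" if "i \<in> {1..M}" for i
    by (intro block_likelihood_measurable W measurable_const c that) auto
  have pw: "ennreal (?w y i) * indicator {y. i \<notin> ?D y} y \<le>
      (\<Sum>J\<in>?JJ. ennreal (\<Prod>k\<in>insert i J. ?w y k powr ?r))" for y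
  proof (cases "i \<in> ?D y")
    case False
    have D: "?D y \<subseteq> {1..M} - {i}" "card (?D y) = m"
      using False card_top_list[of "{1..M}" m "?w y"] top_list_subset[of "{1..M}" m "?w y"] m
      by (auto simp: ml_decoder_def)
    then have finD: "finite (?D y)" using finite_subset by blast
    have "?w y i = (?w y i powr ?r) ^ Suc m"
      using block_likelihood_nonneg[OF W, of n y "c i"]
      by (cases "?w y i = 0") (simp_all add: powr_powr flip: powr_realpow del: of_nat_Suc power_Suc)
    also have "\<dots> = (\<Prod>k\<in>insert i (?D y). ?w y i powr ?r)" using D finD False by simp
    also have "\<dots> \<le> (\<Prod>k\<in>insert i (?D y). ?w y k powr ?r)"
      using top_list_maximal[of "{1..M}" _ m "?w y" i] False i block_likelihood_nonneg[OF W]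
      by (intro prod_mono conjI powr_mono2) (auto simp: ml_decoder_def)
    finally have "ennreal (?w y i) \<le> ennreal (\<Prod>k\<in>insert i (?D y). ?w y k powr ?r)" by (rule ennreal_leI)
    also have "\<dots> \<le> (\<Sum>J\<in>?JJ. ennreal (\<Prod>k\<in>insert i J. ?w y k powr ?r))"
      using D by (intro member_le_sum) auto
    finally show ?thesis using False by simp
  qed simp
  have "(\<integral>\<^sup>+ y. ennreal (?w y i) * indicator {y. i \<notin> ?D y} y \<partial>block_space n) \<le>
      (\<integral>\<^sup>+ y. (\<Sum>J\<in>?JJ. ennreal (\<Prod>k\<in>insert i J. ?w y k powr ?r)) \<partial>block_space n)"
    by (intro nn_integral_mono pw)
  also have "\<dots> = (\<Sum>J\<in>?JJ. affinity n W ?r (insert i J) c)"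
    unfolding affinity_def
    by (intro nn_integral_sum measurable_compose[OF borel_measurable_prod measurable_ennreal] powr_real_measurable measurable_const w_meas)
      (use i in auto)
  finally show ?thesis .
qed

lemma affinity_measurable:
  assumes W: "channel W" and S: "finite S" and X: "\<And>k. k \<in> S \<Longrightarrow> (\<lambda>\<omega>. X \<omega> k) \<in> \<Omega> \<rightarrow>\<^sub>M block_space n"
  shows "(\<lambda>\<omega>. affinity n W r S (X \<omega>)) \<in> borel_measurable \<Omega>"
proof -
  interpret N: sigma_finite_measure "block_space n" by (rule sigma_finite_lborel_on) simp
  have "(\<lambda>p. \<Prod>k\<in>S. block_likelihood n W (snd p) (X (fst p) k) powr r) \<in> borel_measurable (\<Omega> \<Otimes>\<^sub>M block_space n)"
  proof (intro borel_measurable_prod powr_real_measurable block_likelihood_measurable W measurable_snd)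
    fix k assume "k \<in> S"
    from measurable_compose[OF measurable_fst X[OF this]]
    show "(\<lambda>p. X (fst p) k) \<in> \<Omega> \<Otimes>\<^sub>M block_space n \<rightarrow>\<^sub>M block_space n" .
  qed simp
  then have "(\<lambda>(\<omega>, y). ennreal (\<Prod>k\<in>S. block_likelihood n W y (X \<omega> k) powr r)) \<in> borel_measurable (\<Omega> \<Otimes>\<^sub>M block_space n)"
    by (simp add: case_prod_beta')
  from N.borel_measurable_nn_integral[OF this] show ?thesis by (simp add: affinity_def)
qed

lemma affinity_reindex: "inj_on g S \<Longrightarrow> affinity n W r (g ` S) c = affinity n W r S (\<lambda>k. c (g k))"
  by (simp add: affinity_def prod.reindex)

lemma affinity_cong: "(\<And>k. k \<in> S \<Longrightarrow> c k = c' k) \<Longrightarrow> affinity n W r S c = affinity n W r S c'"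
  by (simp add: affinity_def cong: prod.cong)

section \<open>Expurgation\<close>

text \<open>
  Markov's inequality: more than \<open>M\<close> values above \<open>\<theta>\<close> would add up to more than \<open>M * \<theta>\<close>.
\<close>

lemma half_below_twice_mean:
  fixes g :: "'a \<Rightarrow> ennreal"
  assumes A: "finite A" "card A = 2 * M" and \<theta>: "\<theta> < \<infinity>" and le: "(\<Sum>i\<in>A. g i) \<le> of_nat M * \<theta>"
  obtains S where "S \<subseteq> A" "card S = M" "\<And>i. i \<in> S \<Longrightarrow> g i \<le> \<theta>"
proof -
  let ?G = "{i \<in> A. g i \<le> \<theta>}"
  have "M \<le> card ?G"
  proof (rule ccontr)
    assume "\<not> M \<le> card ?G"
    moreover have "card (A - ?G) = 2 * M - card ?G"
      using A by (subst card_Diff_subset) auto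
    ultimately have big: "Suc M \<le> card (A - ?G)" by simp
    then obtain i0 where i0: "i0 \<in> A - ?G" by (cases "A - ?G = {}") auto
    show False
    proof (cases "\<theta> = 0")
      case True
      then have "g i0 = 0" using le A i0 by simp
      then show False using i0 True by auto
    next
      case False
      have "of_nat M * \<theta> < of_nat (Suc M) * \<theta>"
      proof -
        obtain t where t: "\<theta> = ennreal t" "0 \<le> t" using \<theta> by (cases \<theta>) auto
        then have "0 < t" using False by (cases "t = 0") auto
        then show ?thesis using t
          by (simp add: ennreal_of_nat_eq_real_of_nat ennreal_less_iff distrib_right flip: ennreal_mult del: of_nat_Suc)
      qed
      also have "\<dots> \<le> of_nat (card (A - ?G)) * \<theta>"
        using big by (intro mult_right_mono) (auto simp del: of_nat_Suc)
      also have "\<dots> = (\<Sum>i\<in>A - ?G. \<theta>)" by simp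
      also have "\<dots> \<le> (\<Sum>i\<in>A - ?G. g i)" by (intro sum_mono) auto
      also have "\<dots> \<le> (\<Sum>i\<in>A. g i)" using A by (intro sum_mono2) auto
      finally show False using le by simp
    qed
  qed
  then obtain S where "S \<subseteq> ?G" "card S = M"
    by (rule obtain_subset_with_card_n)
  then show thesis by (intro that[of S]) auto
qed

text \<open>
  The gain is \<open>2 M - 1 = (1 - 1 / (2 M)) * (2 M)\<close>, raised to a power of at least 1.
\<close>

lemma expurgation_constant:
  assumes m: "0 < m" and M: "0 < M" and \<rho>: "1 \<le> \<rho>"
  shows "real (2 * ((2 * M - 1) choose m)) powr \<rho> \<le>
    (1 - 1 / (2 * real M)) * (2 powr (real (Suc m) * \<rho>) * real M powr (real m * \<rho>))"
proof -
  let ?\<kappa> = "1 - 1 / (2 * real M)"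
  have \<kappa>: "0 < ?\<kappa>" "?\<kappa> \<le> 1" using M by (auto simp: field_simps)
  have "real ((2 * M - 1) choose m) \<le> real (2 * M - 1) ^ m"
    using choose_le_power[of "2 * M - 1" m] by (simp flip: of_nat_power)
  also have "real (2 * M - 1) = ?\<kappa> * (2 * real M)"
    using M by (simp add: of_nat_diff field_simps)
  also have "\<dots> ^ m = ?\<kappa> ^ m * (2 * real M) ^ m" by (rule power_mult_distrib)
  also have "\<dots> \<le> ?\<kappa> ^ 1 * (2 * real M) ^ m"
    using m \<kappa> by (intro mult_right_mono power_decreasing) auto
  finally have "real (2 * ((2 * M - 1) choose m)) \<le> ?\<kappa> * (2 ^ Suc m * real M ^ m)"
    by (simp add: power_mult_distrib mult_ac)
  then have "real (2 * ((2 * M - 1) choose m)) powr \<rho> \<le> (?\<kappa> * (2 ^ Suc m * real M ^ m)) powr \<rho>"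
    using \<rho> by (intro powr_mono2) auto
  also have "\<dots> = ?\<kappa> powr \<rho> * (2 powr (real (Suc m) * \<rho>) * real M powr (real m * \<rho>))"
    using M \<kappa> by (simp add: powr_mult powr_powr flip: powr_realpow del: of_nat_Suc power_Suc)
  also have "\<dots> \<le> ?\<kappa> * (2 powr (real (Suc m) * \<rho>) * real M powr (real m * \<rho>))"
    using powr_mono'[of 1 \<rho> ?\<kappa>] \<kappa> \<rho> by (intro mult_right_mono) auto
  finally show ?thesis .
qed

context random_codeword
begin

text \<open>
  The affinity and the dominating density both factor over the \<open>n\<close> coordinates, each factor involving
  the \<open>L\<close> codewords at one coordinate.  After transposing the array of \<open>L\<close> codewords of length \<open>n\<close>, the bound
  becomes an \<open>n\<close>-th power.
\<close>

lemma affinity_mean_le: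
  assumes A: "finite A" and S: "S \<subseteq> A" "card S = L"
  shows "(\<integral>\<^sup>+ c. epowr (affinity n W r S c) q \<partial>codebook_dist A) \<le>
    shell_factor ^ L *
      (\<integral>\<^sup>+ x. ennreal (exp (s * (\<Sum>k\<in>{0..<L}. f (x k))) * (\<Prod>k\<in>{0..<L}. P (x k))) *
         epowr (\<integral>\<^sup>+ y. ennreal (\<Prod>i\<in>{0..<L}. W y (x i) powr r) \<partial>lborel) q \<partial>lborel_on {0..<L}) ^ n"
proof -
  let ?K = "{0..<L}"
  interpret lborels: product_sigma_finite "\<lambda>_::nat. lborel :: real measure"
    by (intro product_sigma_finite.intro sigma_finite_lborel)
  define H where "H = (\<lambda>x. ennreal (exp (s * (\<Sum>k\<in>?K. f (x k))) * (\<Prod>k\<in>?K. P (x k))) *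
         epowr (\<integral>\<^sup>+ y. ennreal (\<Prod>i\<in>?K. W y (x i) powr r) \<partial>lborel) q)"
  define \<Phi> where "\<Phi> = (\<lambda>x. epowr (affinity n W r ?K x) q)"
  have coordK [measurable]: "k \<in> ?K \<Longrightarrow> (\<lambda>u. u k) \<in> borel_measurable (lborel_on ?K)" for k
    by (rule coord_measurable)
  have H_meas: "H \<in> borel_measurable (lborel_on ?K)"
  proof -
    have "(\<lambda>p. \<Prod>i\<in>?K. W (snd p) (fst p i) powr r) \<in> borel_measurable (lborel_on ?K \<Otimes>\<^sub>M lborel)"
    proof (intro borel_measurable_prod W_powr_measurable)
      fix i assume "i \<in> ?K"
      from measurable_compose[OF measurable_fst coordK[OF this]]
      show "(\<lambda>p. fst p i) \<in> borel_measurable (lborel_on ?K \<Otimes>\<^sub>M lborel)" .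
    qed simp
    then have "(\<lambda>(x, y). ennreal (\<Prod>i\<in>?K. W y (x i) powr r)) \<in> borel_measurable (lborel_on ?K \<Otimes>\<^sub>M lborel)"
      by (simp add: case_prod_beta')
    from lborel.borel_measurable_nn_integral[OF this]
    have [measurable]: "(\<lambda>x. \<integral>\<^sup>+ y. ennreal (\<Prod>i\<in>?K. W y (x i) powr r) \<partial>lborel) \<in> borel_measurable (lborel_on ?K)" .
    show ?thesis unfolding H_def by measurable
  qed
  have \<Phi>_meas: "\<Phi> \<in> borel_measurable (\<Pi>\<^sub>M k\<in>?K. block_space n)"
    unfolding \<Phi>_def by (intro measurable_epowr affinity_measurable W measurable_component_singleton) auto
  have sets_K: "sets (\<Pi>\<^sub>M k\<in>?K. codeword_dist) = sets (\<Pi>\<^sub>M k\<in>?K. block_space n)"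
    by (intro sets_PiM_cong) auto
  have "finite S" using A S finite_subset by blast
  then obtain g where g: "bij_betw g ?K S"
    using ex_bij_betw_nat_finite[of S] S by auto
  have g': "inj_on g ?K" "g ` ?K = S" using g by (auto simp: bij_betw_def)
  have "affinity n W r S c = affinity n W r ?K (\<lambda>k\<in>?K. c (g k))" for c
    using affinity_reindex[OF g'(1), of n W r c] g'(2) by (auto intro: affinity_cong)
  then have "(\<integral>\<^sup>+ c. epowr (affinity n W r S c) q \<partial>codebook_dist A) =
      (\<integral>\<^sup>+ c. \<Phi> (\<lambda>k\<in>?K. c (g k)) \<partial>codebook_dist A)"
    by (simp add: \<Phi>_def)
  also have "\<dots> = (\<integral>\<^sup>+ x. \<Phi> x \<partial>distr (codebook_dist A) (\<Pi>\<^sub>M k\<in>?K. codeword_dist) (\<lambda>c. \<lambda>k\<in>?K. c (g k)))"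
  proof (rule nn_integral_distr[symmetric])
    show "(\<lambda>c. \<lambda>k\<in>?K. c (g k)) \<in> codebook_dist A \<rightarrow>\<^sub>M (\<Pi>\<^sub>M k\<in>?K. codeword_dist)"
      unfolding codebook_dist_def using g' S by (intro measurable_restrict measurable_component_singleton) auto
    show "\<Phi> \<in> borel_measurable (distr (codebook_dist A) (\<Pi>\<^sub>M k\<in>?K. codeword_dist) (\<lambda>c. \<lambda>k\<in>?K. c (g k)))"
      using \<Phi>_meas sets_K by (simp cong: measurable_cong_sets)
  qed
  also have "distr (codebook_dist A) (\<Pi>\<^sub>M k\<in>?K. codeword_dist) (\<lambda>c. \<lambda>k\<in>?K. c (g k)) = (\<Pi>\<^sub>M k\<in>?K. codeword_dist)"
    unfolding codebook_dist_def
    using distr_PiM_reindex[of A "\<lambda>_. codeword_dist" g ?K] g' S prob_space_codeword_dist by auto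
  also have "(\<integral>\<^sup>+ x. \<Phi> x \<partial>(\<Pi>\<^sub>M k\<in>?K. codeword_dist)) \<le>
      shell_factor ^ card ?K * (\<integral>\<^sup>+ x. (\<Prod>k\<in>?K. ennreal (\<Prod>j\<in>{1..n}. tilt (x k j))) * \<Phi> x \<partial>(\<Pi>\<^sub>M k\<in>?K. block_space n))"
  proof (rule nn_integral_PiM_mono_density)
    show "sigma_finite_measure codeword_dist"
      using prob_space_codeword_dist by (simp add: prob_space_imp_sigma_finite)
    show "sigma_finite_measure (block_space n)" by (rule sigma_finite_lborel_on) simp
    show "(\<lambda>x. ennreal (\<Prod>j\<in>{1..n}. tilt (x j))) \<in> borel_measurable (block_space n)" by measurable
  qed (use \<Phi>_meas nn_integral_codeword_le in auto)
  also have "(\<integral>\<^sup>+ x. (\<Prod>k\<in>?K. ennreal (\<Prod>j\<in>{1..n}. tilt (x k j))) * \<Phi> x \<partial>(\<Pi>\<^sub>M k\<in>?K. block_space n)) =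
      (\<integral>\<^sup>+ x. (\<Prod>j\<in>{1..n}. H (\<lambda>k\<in>?K. x k j)) \<partial>(\<Pi>\<^sub>M k\<in>?K. block_space n))"
  proof (rule nn_integral_cong)
    fix x :: "nat \<Rightarrow> nat \<Rightarrow> real"
    have "affinity n W r ?K x = (\<integral>\<^sup>+ y. (\<Prod>j\<in>{1..n}. ennreal (\<Prod>k\<in>?K. W (y j) (x k j) powr r)) \<partial>block_space n)"
      unfolding affinity_def block_likelihood_powr[OF W]
      by (subst prod.swap) (simp add: prod_ennreal prod_nonneg)
    also have "\<dots> = (\<Prod>j\<in>{1..n}. \<integral>\<^sup>+ y. ennreal (\<Prod>k\<in>?K. W y (x k j) powr r) \<partial>lborel)"
      unfolding lborel_on_def by (rule lborels.product_nn_integral_prod) auto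
    finally have \<Phi>: "\<Phi> x = (\<Prod>j\<in>{1..n}. epowr (\<integral>\<^sup>+ y. ennreal (\<Prod>k\<in>?K. W y (x k j) powr r) \<partial>lborel) q)"
      by (simp add: \<Phi>_def epowr_prod)
    have "(\<Prod>k\<in>?K. ennreal (\<Prod>j\<in>{1..n}. tilt (x k j))) = (\<Prod>j\<in>{1..n}. ennreal (\<Prod>k\<in>?K. tilt (x k j)))"
      by (simp add: prod_ennreal prod_nonneg tilt_nonneg prod.swap[of _ "{1..n}"] del: One_nat_def)
    also have "\<dots> = (\<Prod>j\<in>{1..n}. ennreal (exp (s * (\<Sum>k\<in>?K. f (x k j))) * (\<Prod>k\<in>?K. P (x k j))))"
      by (simp add: tilt_def prod.distrib exp_sum sum_distrib_left mult.commute)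
    finally show "(\<Prod>k\<in>?K. ennreal (\<Prod>j\<in>{1..n}. tilt (x k j))) * \<Phi> x = (\<Prod>j\<in>{1..n}. H (\<lambda>k\<in>?K. x k j))"
      by (simp add: \<Phi> H_def prod.distrib)
  qed
  also have "\<dots> = (\<Prod>j\<in>{1..n}. \<integral>\<^sup>+ u. H u \<partial>lborel_on ?K)"
    using H_meas unfolding lborel_on_def by (intro nn_integral_PiM_transpose sigma_finite_lborel) auto
  finally show ?thesis by (simp add: H_def)
qed

text \<open>
  The decoder is the one for the \<open>M\<close> codewords that are kept.  Its union bound runs over fewer sets of
  competitors than the sums controlled for the original \<open>2 M\<close> codewords.
\<close>

lemma exists_expurgated_code:
  assumes m: "0 < m" "m \<le> M" and \<rho>: "1 \<le> \<rho>"
    and I: "(\<integral>\<^sup>+ x. ennreal (exp (s * (\<Sum>k\<in>{0..<Suc m}. f (x k))) * (\<Prod>k\<in>{0..<Suc m}. P (x k))) *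
         epowr (\<integral>\<^sup>+ y. ennreal (\<Prod>i\<in>{0..<Suc m}. W y (x i) powr (1 / real (Suc m))) \<partial>lborel) (1 / \<rho>)
         \<partial>lborel_on {0..<Suc m}) = I"
    and fin: "shell_factor ^ Suc m * I ^ n < \<infinity>"
  obtains c D where "list_code n M m c D" "satisfies_constraints n M f c"
    "ennreal (P_err_avg n M W c D) \<le>
       epowr (of_nat (2 * ((2 * M - 1) choose m)) * (shell_factor ^ Suc m * I ^ n)) \<rho>"
proof -
  let ?A = "{1..2 * M}" and ?r = "1 / real (Suc m)"
  let ?JJ = "\<lambda>i. {J. J \<subseteq> ?A - {i} \<and> card J = m}"
  let ?b = "\<lambda>i J c. epowr (affinity n W ?r (insert i J) c) (1 / \<rho>)"
  let ?g = "\<lambda>c i. \<Sum>J\<in>?JJ i. ?b i J c"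
  define E where "E = shell_factor ^ Suc m * I ^ n"
  define \<theta> where "\<theta> = of_nat (2 * ((2 * M - 1) choose m)) * E"
  have finJ: "finite J" if "J \<in> ?JJ i" for i J
    using that by (auto dest: finite_subset)
  have b_meas: "?b i J \<in> borel_measurable (codebook_dist ?A)" if "i \<in> ?A" "J \<in> ?JJ i" for i J
    using that finJ[OF that(2)] by (intro measurable_epowr affinity_measurable W codeword_measurable) auto
  have b_mean: "(\<integral>\<^sup>+ c. ?b i J c \<partial>codebook_dist ?A) \<le> E" if "i \<in> ?A" "J \<in> ?JJ i" for i J
  proof -
    have "i \<notin> J" using that by auto
    then show ?thesis
      unfolding E_def I[symmetric] using that finJ[OF that(2)] by (intro affinity_mean_le) auto
  qed
  have "(\<integral>\<^sup>+ c. (\<Sum>i\<in>?A. ?g c i) \<partial>codebook_dist ?A) = (\<Sum>i\<in>?A. \<integral>\<^sup>+ c. ?g c i \<partial>codebook_dist ?A)"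
    by (intro nn_integral_sum borel_measurable_sum b_meas)
  also have "\<dots> = (\<Sum>i\<in>?A. \<Sum>J\<in>?JJ i. \<integral>\<^sup>+ c. ?b i J c \<partial>codebook_dist ?A)"
    by (intro sum.cong refl nn_integral_sum b_meas)
  also have "\<dots> \<le> (\<Sum>i\<in>?A. \<Sum>J\<in>?JJ i. E)" by (intro sum_mono b_mean)
  also have "\<dots> = of_nat (2 * M) * (of_nat ((2 * M - 1) choose m) * E)"
  proof -
    have "(\<Sum>J\<in>?JJ i. E) = of_nat ((2 * M - 1) choose m) * E" if "i \<in> ?A" for i
      using that n_subsets[of "?A - {i}" m] by simp
    then show ?thesis by simp
  qed
  also have "\<dots> = of_nat M * \<theta>" by (simp add: \<theta>_def mult_ac)
  finally have mean: "(\<integral>\<^sup>+ c. (\<Sum>i\<in>?A. ?g c i) \<partial>codebook_dist ?A) \<le> of_nat M * \<theta>" .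
  have \<theta>_fin: "\<theta> < \<infinity>"
    using fin unfolding \<theta>_def E_def[symmetric] infinity_ennreal_def ennreal_mult_less_top
    by (simp only: of_nat_less_top simp_thms)
  then have M\<theta>_fin: "of_nat M * \<theta> < \<infinity>" by (simp add: ennreal_mult_less_top of_nat_less_top)
  have g_meas: "(\<lambda>c. \<Sum>i\<in>?A. ?g c i) \<in> borel_measurable (codebook_dist ?A)"
    by (intro borel_measurable_sum b_meas)
  obtain c where c: "\<And>i. i \<in> ?A \<Longrightarrow> c i \<in> space (block_space n)"
      "\<And>i. i \<in> ?A \<Longrightarrow> (\<Sum>j\<in>{1..n}. f (c i j)) \<le> 0" "(\<Sum>i\<in>?A. ?g c i) \<le> of_nat M * \<theta>"
    by (rule exists_codebook_le_mean[OF finite_atLeastAtMost g_meas mean M\<theta>_fin]) blast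
  obtain S where S: "S \<subseteq> ?A" "card S = M" "\<And>i. i \<in> S \<Longrightarrow> ?g c i \<le> \<theta>"
    using half_below_twice_mean[OF _ _ \<theta>_fin c(3)] by auto
  have "finite S" using S(1) finite_subset by blast
  then obtain h where h: "bij_betw h {1..M} S"
    using ex_bij_betw_nat_finite_1[of S] S(2) by auto
  then have h': "inj_on h {1..M}" "h ` {1..M} = S" by (auto simp: bij_betw_def)
  define c' where "c' = (\<lambda>i. c (h i))"
  have hA: "h i \<in> ?A" if "i \<in> {1..M}" for i using h' S(1) that by blast
  have c'_space: "c' i \<in> space (block_space n)" if "i \<in> {1..M}" for i
    unfolding c'_def by (rule c(1)[OF hA[OF that]])
  let ?D = "ml_decoder n W M m c'"
  have err: "(\<integral>\<^sup>+ y. ennreal (block_likelihood n W y (c' i)) * indicator {y. i \<notin> ?D y} y \<partial>block_space n) \<le> epowr \<theta> \<rho>"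
    if i: "i \<in> {1..M}" for i
  proof -
    let ?JM = "{J. J \<subseteq> {1..M} - {i} \<and> card J = m}"
    have "(\<integral>\<^sup>+ y. ennreal (block_likelihood n W y (c' i)) * indicator {y. i \<notin> ?D y} y \<partial>block_space n) \<le>
        (\<Sum>J\<in>?JM. affinity n W ?r (insert i J) c')"
      by (rule ml_error_le_affinity[OF W m c'_space i])
    also have "\<dots> = (\<Sum>J\<in>?JM. affinity n W ?r (insert (h i) (h ` J)) c)"
    proof (rule sum.cong[OF refl])
      fix J assume "J \<in> ?JM"
      then have "inj_on h (insert i J)" using i by (intro inj_on_subset[OF h'(1)]) auto
      from affinity_reindex[OF this, of n W ?r c]
      show "affinity n W ?r (insert i J) c' = affinity n W ?r (insert (h i) (h ` J)) c"
        by (simp add: c'_def)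
    qed
    also have "\<dots> = (\<Sum>J\<in>(`) h ` ?JM. affinity n W ?r (insert (h i) J) c)"
    proof (subst sum.reindex)
      show "inj_on ((`) h) ?JM"
        by (rule inj_on_subset[OF inj_on_image_Pow[OF h'(1)]]) auto
    qed (simp add: o_def)
    also have "\<dots> \<le> (\<Sum>J\<in>?JJ (h i). affinity n W ?r (insert (h i) J) c)"
    proof (rule sum_mono2)
      show "(`) h ` ?JM \<subseteq> ?JJ (h i)"
      proof safe
        fix J assume J: "J \<subseteq> {1..M} - {i}" "m = card J"
        show "card (h ` J) = card J"
          using J by (intro card_image inj_on_subset[OF h'(1)]) auto
        fix k assume k: "k \<in> J"
        then show "h k \<in> ?A" using J hA by blast
        show False if "h k = h i"
          using inj_onD[OF h'(1) that] k J i by auto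
      qed
    qed auto
    also have "\<dots> = epowr (epowr (\<Sum>J\<in>?JJ (h i). affinity n W ?r (insert (h i) J) c) (1 / \<rho>)) \<rho>"
      using \<rho> by (simp add: epowr_epowr)
    also have "\<dots> \<le> epowr \<theta> \<rho>"
    proof (rule epowr_mono)
      have "epowr (\<Sum>J\<in>?JJ (h i). affinity n W ?r (insert (h i) J) c) (1 / \<rho>) \<le> ?g c (h i)"
        using \<rho> by (intro epowr_sum_le) auto
      also have "\<dots> \<le> \<theta>" using i h' by (intro S(3)) auto
      finally show "epowr (\<Sum>J\<in>?JJ (h i). affinity n W ?r (insert (h i) J) c) (1 / \<rho>) \<le> \<theta>" .
    qed (use \<rho> in simp)
    finally show ?thesis .
  qed
  have code: "list_code n M m c' ?D" by (rule list_code_ml_decoder[OF W m(2) c'_space])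
  have "ennreal (P_err_avg n M W c' ?D) \<le> (\<Sum>i\<in>{1..M}. epowr \<theta> \<rho>) / of_nat M"
    using m by (intro order_trans[OF P_err_avg_le[OF W code]] divide_right_mono_ennreal sum_mono err) auto
  also have "\<dots> = epowr \<theta> \<rho>"
    using m by (simp add: mult.commute[of _ "epowr \<theta> \<rho>"] ennreal_mult_divide_eq)
  finally show thesis
    unfolding \<theta>_def E_def using c(2)[OF hA] code
    by (intro that[of c' ?D]) (auto simp: satisfies_constraints_def c'_def)
qed

end

section \<open>Reaching the infimum\<close>

text \<open>
  If the cost were positive everywhere, then no density could have a nonpositive mean cost.  A codebook
  repeating a letter of nonpositive cost is feasible.  It serves when the bound is infinite.
\<close>

lemma exists_feasible_code:
  assumes W: "channel W" and feasible: "constraint_set f \<noteq> {}" and m: "m \<le> M"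
  shows "\<exists>c D. list_code n M m c D \<and> satisfies_constraints n M f c"
proof -
  obtain P where P: "prob_density P" "integrable lborel (\<lambda>x. P x * f x)" "(LINT x|lborel. P x * f x) \<le> 0"
    using feasible by (auto simp: constraint_set_def)
  have P_nonneg: "0 \<le> P x" for x using P(1) by (simp add: prob_density_def)
  have "\<exists>x. f x \<le> 0"
  proof (rule ccontr)
    assume "\<not> ?thesis"
    then have pos: "0 < f x" for x by (simp add: not_le)
    then have nonneg: "0 \<le> P x * f x" for x using P_nonneg by (simp add: less_imp_le)
    have "(LINT x|lborel. P x * f x) = 0"
      using P(3) nonneg by (intro antisym) (auto intro!: integral_nonneg)
    then have "AE x in lborel. P x * f x = 0"
      using integral_nonneg_eq_0_iff_AE[OF P(2)] nonneg by simp
    then have "AE x in lborel. ennreal (P x) = 0"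
    proof eventually_elim
      case (elim x)
      then show ?case using pos[of x] by simp
    qed
    then have "(\<integral>\<^sup>+ x. ennreal (P x) \<partial>lborel) = 0" by (simp add: nn_integral_cong_AE)
    then show False using P(1) by (simp add: prob_density_def)
  qed
  then obtain x0 where x0: "f x0 \<le> 0" ..
  define c :: "nat \<Rightarrow> nat \<Rightarrow> real" where "c = (\<lambda>i. \<lambda>j\<in>{1..n}. x0)"
  have "c i \<in> space (block_space n)" for i
    by (auto simp: c_def lborel_on_def space_PiM)
  moreover have "satisfies_constraints n M f c"
    using x0 by (auto simp: satisfies_constraints_def c_def intro!: mult_nonneg_nonpos)
  ultimately show ?thesis using list_code_ml_decoder[OF W m] by blast
qed

text \<open>
  For a positive finite \<open>B\<close> the slack is spent on passing from \<open>B / \<kappa>\<close>, below which there are terms,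
  to \<open>B\<close>.
\<close>

lemma infimum_achieved_with_slack:
  fixes B :: ennreal and err :: "'a \<Rightarrow> real"
  assumes \<kappa>: "0 < \<kappa>" "\<kappa> < 1"
    and slack: "\<And>b. B < b \<Longrightarrow> b < \<infinity> \<Longrightarrow> \<exists>x. Q x \<and> ennreal (err x) \<le> ennreal \<kappa> * b"
    and ex: "\<exists>x. Q x"
  shows "(B > 0 \<longrightarrow> (\<exists>x. Q x \<and> ennreal (err x) \<le> B)) \<and> (B = 0 \<longrightarrow> (\<forall>\<epsilon>>0. \<exists>x. Q x \<and> err x \<le> \<epsilon>))"
proof (intro conjI impI allI)
  assume B: "B > 0"
  show "\<exists>x. Q x \<and> ennreal (err x) \<le> B"
  proof (cases B rule: ennreal_cases)
    case top
    then show ?thesis using ex by simp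
  next
    case (real b)
    then have b: "0 < b" using B by (simp add: ennreal_less_zero_iff)
    have "ennreal b < ennreal (b / \<kappa>)"
      using b \<kappa> by (intro ennreal_lessI) (auto simp: field_simps)
    from slack[of "ennreal (b / \<kappa>)"] this obtain x where "Q x" "ennreal (err x) \<le> ennreal \<kappa> * ennreal (b / \<kappa>)"
      using real by auto
    then show ?thesis using \<kappa> b real by (auto simp flip: ennreal_mult)
  qed
next
  fix \<epsilon> :: real assume B: "B = 0" and \<epsilon>: "\<epsilon> > 0"
  then obtain x where x: "Q x" "ennreal (err x) \<le> ennreal \<kappa> * ennreal \<epsilon>"
    using slack[of "ennreal \<epsilon>"] by auto
  then have "ennreal (err x) \<le> ennreal (\<kappa> * \<epsilon>)" using \<kappa> \<epsilon> by (simp add: ennreal_mult)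
  then have "err x \<le> \<kappa> * \<epsilon>" using \<kappa> \<epsilon> by (simp add: ennreal_le_iff)
  also have "\<dots> \<le> \<epsilon>" using \<kappa> \<epsilon> by simp
  finally show "\<exists>x. Q x \<and> err x \<le> \<epsilon>" using x(1) by auto
qed

lemma exp_rate: "0 < n \<Longrightarrow> 0 < M \<Longrightarrow> exp (real n * code_rate n M * k * \<rho>) = real M powr (k * \<rho>)"
  by (simp add: code_rate_def powr_def mult_ac)

lemma random_coding_term_achieved:
  assumes L: "L \<ge> 2" and n: "n \<ge> 1" and M: "M \<ge> L - 1" and W: "channel W" and f: "f \<in> borel_measurable borel"
    and P: "P \<in> constraint_set f" and s: "0 \<le> s" and \<rho>: "0 \<le> \<rho>" "\<rho> \<le> 1"
    and fin: "rc_term n L (code_rate n M) W f P \<delta> s \<rho> < \<infinity>"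
  shows "\<exists>c D. list_code n M (L - 1) c D \<and> satisfies_constraints n M f c \<and>
    ennreal (P_err_avg n M W c D) \<le> ennreal (1 - 1 / (2 * real M)) * rc_term n L (code_rate n M) W f P \<delta> s \<rho>"
proof -
  have Z: "shell_mass n f P \<delta> \<noteq> 0" using fin by (auto simp: rc_term_def)
  interpret random_codeword n W f P \<delta> s
    using W f P s Z by unfold_locales (auto simp: constraint_set_def)
  have m: "0 < L - 1" using L by simp
  have Lm: "real L - 1 = real (L - 1)" using L by simp
  have "rc_term n L (code_rate n M) W f P \<delta> s \<rho> =
      ennreal (real M powr (real (L - 1) * \<rho>)) * epowr shell_factor (1 + real (L - 1) * \<rho>) *
      (\<integral>\<^sup>+ y. epowr (\<integral>\<^sup>+ x. ennreal (P x * exp (s * f x) * W y x powr (1 / (1 + real (L - 1) * \<rho>))) \<partial>lborel)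
        (1 + real (L - 1) * \<rho>) \<partial>lborel) ^ n"
    using Z L n M by (simp only: rc_term_def Let_def if_False shell_factor_def Lm) (simp add: exp_rate)
  from exists_random_code[OF m M \<rho> refl this fin] show ?thesis by blast
qed

lemma expurgated_term_achieved:
  assumes L: "L \<ge> 2" and n: "n \<ge> 1" and M: "M \<ge> L - 1" and W: "channel W" and f: "f \<in> borel_measurable borel"
    and P: "P \<in> constraint_set f" and s: "0 \<le> s" and \<rho>: "1 \<le> \<rho>"
    and fin: "ex_term n L (code_rate n M) W f P \<delta> s \<rho> < \<infinity>"
  shows "\<exists>c D. list_code n M (L - 1) c D \<and> satisfies_constraints n M f c \<and>
    ennreal (P_err_avg n M W c D) \<le> ennreal (1 - 1 / (2 * real M)) * ex_term n L (code_rate n M) W f P \<delta> s \<rho>"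
proof -
  define m where "m = L - 1"
  have m: "0 < m" "L = Suc m" "m \<le> M" using L M by (auto simp: m_def)
  have M0: "0 < M" using m by simp
  have Z: "shell_mass n f P \<delta> \<noteq> 0" using fin by (auto simp: ex_term_def)
  interpret random_codeword n W f P \<delta> s
    using W f P s Z by unfold_locales (auto simp: constraint_set_def)
  define I where "I = (\<integral>\<^sup>+ x. ennreal (exp (s * (\<Sum>k\<in>{0..<Suc m}. f (x k))) * (\<Prod>k\<in>{0..<Suc m}. P (x k))) *
         epowr (\<integral>\<^sup>+ y. ennreal (\<Prod>i\<in>{0..<Suc m}. W y (x i) powr (1 / real (Suc m))) \<partial>lborel) (1 / \<rho>)
         \<partial>lborel_on {0..<Suc m})"
  define k where "k = 2 powr (real (Suc m) * \<rho>) * real M powr (real m * \<rho>)"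
  have k: "0 < k" using M0 by (simp add: k_def)
  let ?E = "shell_factor ^ Suc m * I ^ n"
  have term_eq: "ex_term n L (code_rate n M) W f P \<delta> s \<rho> = ennreal k * epowr ?E \<rho>"
  proof -
    have "epowr ?E \<rho> = epowr shell_factor (real (Suc m) * \<rho>) * epowr I (\<rho> * real n)"
      using n epowr_of_nat[of "Suc m" shell_factor] epowr_of_nat[of n I]
      by (simp only: epowr_mult mult.commute[of \<rho>] flip: epowr_epowr)
    moreover have "ex_term n L (code_rate n M) W f P \<delta> s \<rho> =
        ennreal (2 powr (real (Suc m) * \<rho>) * exp (real n * code_rate n M * real m * \<rho>)) *
        epowr shell_factor (real (Suc m) * \<rho>) * epowr I (\<rho> * real n)"
      using Z by (simp add: ex_term_def I_def shell_factor_def m(2))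
    moreover have "exp (real n * code_rate n M * real m * \<rho>) = real M powr (real m * \<rho>)"
      using n M0 by (intro exp_rate) auto
    ultimately show ?thesis unfolding k_def by (simp only: mult.assoc[of _ "epowr _ _"])
  qed
  have E_fin: "?E < \<infinity>"
  proof (rule ccontr)
    assume "\<not> ?E < \<infinity>"
    then have "?E = \<infinity>" by (simp add: less_top[symmetric])
    then show False using fin k unfolding term_eq by (simp add: ennreal_mult_top)
  qed
  from exists_expurgated_code[OF m(1,3) \<rho> I_def[symmetric] E_fin]
  obtain c D where c: "list_code n M m c D" "satisfies_constraints n M f c"
    "ennreal (P_err_avg n M W c D) \<le> epowr (of_nat (2 * ((2 * M - 1) choose m)) * ?E) \<rho>" .
  note c(3)
  also have "epowr (of_nat (2 * ((2 * M - 1) choose m)) * ?E) \<rho> =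
      ennreal (real (2 * ((2 * M - 1) choose m)) powr \<rho>) * epowr ?E \<rho>"
    unfolding ennreal_of_nat_eq_real_of_nat
    by (rule trans[OF epowr_mult]) (simp only: epowr_ennreal of_nat_0_le_iff)
  also have "\<dots> \<le> ennreal ((1 - 1 / (2 * real M)) * k) * epowr ?E \<rho>"
    unfolding k_def by (intro mult_right_mono ennreal_leI expurgation_constant m M0 \<rho>) auto
  also have "\<dots> = ennreal (1 - 1 / (2 * real M)) * ex_term n L (code_rate n M) W f P \<delta> s \<rho>"
    unfolding term_eq using k M0 by (subst ennreal_mult) (auto simp: mult.assoc field_simps)
  finally show ?thesis using c(1,2) by (auto simp: m_def)
qed

theorem mainTheorem11:
  fixes L n M :: nat and R :: real
    and W :: "real \<Rightarrow> real \<Rightarrow> real" and f :: "real \<Rightarrow> real"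
  assumes "L \<ge> 2" and "n \<ge> 1"
    and "M \<ge> L - 1" and "R = code_rate n M"
    and "channel W"
    and "f \<in> borel_measurable borel"
    and "constraint_set f \<noteq> {}"
  shows "(let B = random_coding_bound n L R W f in
            (B > 0 \<longrightarrow>
               (\<exists>c D. list_code n M (L - 1) c D \<and> satisfies_constraints n M f c \<and>
                      ennreal (P_err_avg n M W c D) \<le> B)) \<and>
            (B = 0 \<longrightarrow>
               (\<forall>\<epsilon>>0. \<exists>c D. list_code n M (L - 1) c D \<and> satisfies_constraints n M f c \<and>
                            P_err_avg n M W c D \<le> \<epsilon>))) \<and>
         (let B = expurgated_bound n L R W f in
            (B > 0 \<longrightarrow>
               (\<exists>c D. list_code n M (L - 1) c D \<and> satisfies_constraints n M f c \<and>
                      ennreal (P_err_avg n M W c D) \<le> B)) \<and>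
            (B = 0 \<longrightarrow>
               (\<forall>\<epsilon>>0. \<exists>c D. list_code n M (L - 1) c D \<and> satisfies_constraints n M f c \<and>
                            P_err_avg n M W c D \<le> \<epsilon>)))"
proof -
  let ?Q = "\<lambda>(c, D). list_code n M (L - 1) c D \<and> satisfies_constraints n M f c"
  let ?err = "\<lambda>(c, D). P_err_avg n M W c D"
  let ?\<kappa> = "1 - 1 / (2 * real M)"
  have \<kappa>: "0 < ?\<kappa>" "?\<kappa> < 1" using assms(1,3) by (auto simp: field_simps)
  have ex: "\<exists>x. ?Q x" using exists_feasible_code[OF assms(5,7,3)] by simp
  have rc: "\<exists>x. ?Q x \<and> ennreal (?err x) \<le> ennreal ?\<kappa> * b"
    if b: "random_coding_bound n L R W f < b" "b < \<infinity>" for b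
  proof -
    from b(1) obtain P \<delta> s \<rho> where t: "P \<in> constraint_set f" "0 \<le> s" "0 \<le> \<rho>" "\<rho> \<le> 1"
        "rc_term n L R W f P \<delta> s \<rho> < b"
      by (auto simp: random_coding_bound_def INF_less_iff)
    then have fin: "rc_term n L R W f P \<delta> s \<rho> < \<infinity>" using b(2) by (blast intro: less_trans)
    obtain c D where "list_code n M (L - 1) c D" "satisfies_constraints n M f c"
        "ennreal (P_err_avg n M W c D) \<le> ennreal ?\<kappa> * rc_term n L R W f P \<delta> s \<rho>"
      using random_coding_term_achieved[OF assms(1-3,5,6) t(1-4), folded assms(4), OF fin] by blast
    moreover have "ennreal ?\<kappa> * rc_term n L R W f P \<delta> s \<rho> \<le> ennreal ?\<kappa> * b"
      using t(5) by (intro mult_left_mono) auto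
    ultimately show ?thesis by (intro exI[of _ "(c, D)"]) auto
  qed
  have expurg: "\<exists>x. ?Q x \<and> ennreal (?err x) \<le> ennreal ?\<kappa> * b"
    if b: "expurgated_bound n L R W f < b" "b < \<infinity>" for b
  proof -
    from b(1) obtain P \<delta> s \<rho> where t: "P \<in> constraint_set f" "0 \<le> s" "1 \<le> \<rho>"
        "ex_term n L R W f P \<delta> s \<rho> < b"
      by (auto simp: expurgated_bound_def INF_less_iff)
    then have fin: "ex_term n L R W f P \<delta> s \<rho> < \<infinity>" using b(2) by (blast intro: less_trans)
    obtain c D where "list_code n M (L - 1) c D" "satisfies_constraints n M f c"
        "ennreal (P_err_avg n M W c D) \<le> ennreal ?\<kappa> * ex_term n L R W f P \<delta> s \<rho>"
      using expurgated_term_achieved[OF assms(1-3,5,6) t(1-3), folded assms(4), OF fin] by blast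
    moreover have "ennreal ?\<kappa> * ex_term n L R W f P \<delta> s \<rho> \<le> ennreal ?\<kappa> * b"
      using t(4) by (intro mult_left_mono) auto
    ultimately show ?thesis by (intro exI[of _ "(c, D)"]) auto
  qed
  show ?thesis
    using infimum_achieved_with_slack[OF \<kappa> rc ex] infimum_achieved_with_slack[OF \<kappa> expurg ex]
    by (simp add: Let_def)
qed

end
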